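(* Let $p$ be a prime, let $F\in\mathbb{F}_p[t]$ be a monic irreducible polynomial of degree $d\ge1$, and put $\alpha_n:=\frac{\log n}{dn}$. For each $n$, let $B_n\in\mathrm{Mat}_n(\mathbb{F}_p)$ be a deterministic block diagonal matrix consisting of $\lfloor n/d\rfloor$ copies of the companion matrix $C(F)$, apart from a final block of size less than $d$. Let $A_n\in\mathrm{Mat}_n(\mathbb{F}_p)$ be a random matrix with independent entries satisfying $$\mathbf{P}(A_{ij}=(B_n)_{ij})=1-\alpha_n,\qquad \mathbf{P}(A_{ij}=(B_n)_{ij}+1)=\alpha_n.$$ Then $A_n$ is $\alpha_n$-balanced for all sufficiently large $n$, and the distribution of the partition $\lambda^{(F)}(A_n)$ does not converge pointwise, as $n\to\infty$, to the measure $\mu_F$ on $\mathbb{Y}$ given by $$\mu_F(\lambda)=\frac{1}{\#\mathrm{Aut}_F(\lambda)}\prod_{\ell=1}^\infty\left(1-p^{-\ell d}\right),\qquad \lambda\in\mathbb{Y}.$$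
   Context: $\mathbb{F}_p$ is the field with $p$ elements and $\mathrm{Mat}_n(\mathbb{F}_p)$ the set of $n\times n$ matrices over it. Balanced matrices: for $\alpha>0$, a random variable $\xi\in\mathbb{F}_p$ is $\alpha$-balanced if $\mathbf{P}(\xi=a)\le 1-\alpha$ for every $a\in\mathbb{F}_p$. A random matrix over $\mathbb{F}_p$ is $\alpha$-balanced if its entries are independent and each is $\alpha$-balanced. Partitions: $\mathbb{Y}$ is the set of integer partitions $\lambda=(\lambda_1\ge\lambda_2\ge\cdots\ge 0)$, $\lambda_i\in\mathbb{Z}$, with $\lambda_i=0$ for all but finitely many $i$. Companion matrices: for a monic $f(t)=t^r+a_{r-1}t^{r-1}+\cdots+a_0\in\mathbb{F}_p[t]$, the companion matrix $C(f)$ is the $r\times r$ matrix with $1$'s on the superdiagonal, last row $(-a_0,-a_1,\ldots,-a_{r-1})$, and zeros elsewhere. Rational canonical form: every $A\in\mathrm{Mat}_n(\mathbb{F}_p)$ is conjugate under $\mathrm{GL}_n(\mathbb{F}_p)$ to a block diagonal matrix whose blocks are $C(F^{\lambda_j^{(F)}})$, where $F$ ranges over the distinct monic irreducible factors of $\det(tI_n-A)$ and $\lambda^{(F)}=(\lambda^{(F)}_1\ge\lambda^{(F)}_2\ge\cdots)\in\mathbb{Y}$ (with $j$ ranging over its positive parts). This form is unique up to the order of blocks, so $\lambda^{(F)}=\lambda^{(F)}(A)$ is well defined; it is the zero partition if $F\nmid\det(tI_n-A)$. Equivalently, the $F$-primary part of the $\mathbb{F}_p[t]$-module $\mathrm{Cok}_{\mathbb{F}_p[t]}(tI_n-A)$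 is isomorphic to $\bigoplus_{j\ge1}\mathbb{F}_p[t]/(F^{\lambda_j^{(F)}})$. $\mathrm{Aut}_F(\lambda)$ denotes the group of automorphisms of the $\mathbb{F}_p[t]$-module $\bigoplus_{j\ge1}\mathbb{F}_p[t]/(F^{\lambda_j})$. Pointwise convergence to $\mu_F$ means $\mathbf{P}(\lambda^{(F)}(A_n)=\lambda)\to\mu_F(\lambda)$ for every $\lambda\in\mathbb{Y}$. *)

theory Defs
  imports
    "HOL-Probability.Probability"
    "Jordan_Normal_Form.Char_Poly"
begin

text \<open>The field with \<open>p\<close> elements is rendered as a type \<open>'k :: {field, finite}\<close> with
  \<open>CARD('k) = p\<close> prime. Matrix indices start from 0.\<close>

subsection \<open>Balanced random variables and matrices\<close>

definition balanced_var :: "'w measure \<Rightarrow> real \<Rightarrow> ('w \<Rightarrow> 'k) \<Rightarrow> bool" where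
  "balanced_var M \<alpha> X \<longleftrightarrow> \<alpha> > 0 \<and> X \<in> measurable M (count_space UNIV) \<and>
     (\<forall>a. measure M {w \<in> space M. X w = a} \<le> 1 - \<alpha>)"

definition random_matrix :: "'w measure \<Rightarrow> nat \<Rightarrow> ('w \<Rightarrow> 'k mat) \<Rightarrow> bool" where
  "random_matrix M n X \<longleftrightarrow> (\<forall>w\<in>space M. X w \<in> carrier_mat n n) \<and>
     (\<forall>i<n. \<forall>j<n. (\<lambda>w. X w $$ (i, j)) \<in> measurable M (count_space UNIV))"

definition indep_entries :: "'w measure \<Rightarrow> nat \<Rightarrow> ('w \<Rightarrow> 'k mat) \<Rightarrow> bool" where
  "indep_entries M n X \<longleftrightarrow>
     prob_space.indep_vars M (\<lambda>_. count_space UNIV) (\<lambda>ij w. X w $$ ij) ({..<n} \<times> {..<n})"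

definition balanced_mat :: "'w measure \<Rightarrow> nat \<Rightarrow> real \<Rightarrow> ('w \<Rightarrow> 'k mat) \<Rightarrow> bool" where
  "balanced_mat M n \<alpha> X \<longleftrightarrow> random_matrix M n X \<and> indep_entries M n X \<and>
     (\<forall>i<n. \<forall>j<n. balanced_var M \<alpha> (\<lambda>w. X w $$ (i, j)))"

subsection \<open>Partitions\<close>

text \<open>A partition is an infinite sequence; the part written \<open>\<lambda>\<^sub>j\<close>, \<open>j \<ge> 1\<close>, on paper is
  \<open>lam (j - 1)\<close> here.\<close>

definition partitions :: "(nat \<Rightarrow> nat) set" where
  "partitions = {lam. decseq lam \<and> finite {j. lam j > 0}}"

definition num_parts :: "(nat \<Rightarrow> nat) \<Rightarrow> nat" where
  "num_parts lam = card {j. lam j > 0}"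

subsection \<open>Companion matrices and the rational canonical form\<close>

definition companion_mat :: "'a::comm_ring_1 poly \<Rightarrow> 'a mat" where
  "companion_mat f = Matrix.mat (degree f) (degree f) (\<lambda>(i, j).
     if i = degree f - 1 then - coeff f j else if j = i + 1 then 1 else 0)"

definition irred_factors :: "'k::field mat \<Rightarrow> 'k poly set" where
  "irred_factors A = {G. lead_coeff G = 1 \<and> irreducible G \<and> G dvd char_poly A}"

definition companion_blocks :: "'k::field poly \<Rightarrow> (nat \<Rightarrow> nat) \<Rightarrow> 'k mat list" where
  "companion_blocks G lam = map (\<lambda>j. companion_mat (G ^ lam j)) [0..<num_parts lam]"

text \<open>\<open>L\<close> is the family of partitions of a rational canonical form of \<open>A\<close>. The enumeration
  \<open>Gs\<close> of the irreducible factors is arbitrary, since the order of the blocks does not matter.\<close>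

definition is_rcf :: "'k::field mat \<Rightarrow> ('k poly \<Rightarrow> nat \<Rightarrow> nat) \<Rightarrow> bool" where
  "is_rcf A L \<longleftrightarrow>
     (\<forall>G. L G \<in> partitions) \<and>
     (\<forall>G. G \<notin> irred_factors A \<longrightarrow> L G = (\<lambda>_. 0)) \<and>
     (\<exists>Gs. distinct Gs \<and> set Gs = irred_factors A \<and>
        similar_mat A (diag_block_mat (concat (map (\<lambda>G. companion_blocks G (L G)) Gs))))"

text \<open>For square \<open>A\<close> over a field there is exactly one \<open>L\<close> with \<open>is_rcf A L\<close> (rational canonical
  form), so the choice operator merely names it.\<close>

definition rcf_partition :: "'k::field poly \<Rightarrow> 'k mat \<Rightarrow> (nat \<Rightarrow> nat)" where
  "rcf_partition G A = (SOME L. is_rcf A L) G"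

subsection \<open>The limiting measure\<close>

text \<open>The module \<open>\<Oplus>\<^sub>j k[t]/(F^lam j)\<close>, an element of each summand being given by its
  representative reduced modulo \<open>F ^ lam j\<close>. Summands with \<open>lam j = 0\<close> vanish because
  \<open>x mod 1 = 0\<close>, so for a partition all elements have finite support. Reduced
  representatives are closed under addition, which is therefore componentwise.\<close>

definition primary_module :: "'k::field poly \<Rightarrow> (nat \<Rightarrow> nat) \<Rightarrow> (nat \<Rightarrow> 'k poly) set" where
  "primary_module F lam = {x. \<forall>j. x j mod F ^ lam j = x j}"

definition primary_smult ::
  "'k::field poly \<Rightarrow> (nat \<Rightarrow> nat) \<Rightarrow> 'k poly \<Rightarrow> (nat \<Rightarrow> 'k poly) \<Rightarrow> (nat \<Rightarrow> 'k poly)" where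
  "primary_smult F lam f x = (\<lambda>j. (f * x j) mod F ^ lam j)"

text \<open>Restriction to extensional functions makes the maps determined by their values on the
  module, so that the cardinality of this set is the order of the automorphism group.\<close>

definition primary_Aut ::
  "'k::field poly \<Rightarrow> (nat \<Rightarrow> nat) \<Rightarrow> ((nat \<Rightarrow> 'k poly) \<Rightarrow> (nat \<Rightarrow> 'k poly)) set" where
  "primary_Aut F lam = {\<phi> \<in> extensional (primary_module F lam).
     bij_betw \<phi> (primary_module F lam) (primary_module F lam) \<and>
     (\<forall>x\<in>primary_module F lam. \<forall>y\<in>primary_module F lam.
        \<phi> (\<lambda>j. x j + y j) = (\<lambda>j. \<phi> x j + \<phi> y j)) \<and>
     (\<forall>f. \<forall>x\<in>primary_module F lam. \<phi> (primary_smult F lam f x) = primary_smult F lam f (\<phi> x))}"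

text \<open>The product index is shifted by one: the paper's \<open>\<ell>\<close> is \<open>Suc l\<close>.\<close>

definition mu :: "'k::{field, finite} poly \<Rightarrow> (nat \<Rightarrow> nat) \<Rightarrow> real" where
  "mu F lam = 1 / real (card (primary_Aut F lam)) *
     (\<Prod>l. 1 - 1 / real CARD('k) ^ (Suc l * degree F))"

subsection \<open>The perturbed block matrices\<close>

definition alpha_seq :: "nat \<Rightarrow> nat \<Rightarrow> real" where
  "alpha_seq d n = ln (real n) / (real d * real n)"

text \<open>The final block \<open>R\<close> of size \<open>n mod degree F\<close> is arbitrary.\<close>

definition is_companion_block_mat :: "'k::field poly \<Rightarrow> nat \<Rightarrow> 'k mat \<Rightarrow> bool" where
  "is_companion_block_mat F n B \<longleftrightarrow>
     (\<exists>R \<in> carrier_mat (n mod degree F) (n mod degree F).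
        B = diag_block_mat (replicate (n div degree F) (companion_mat F) @ [R]))"

end

theory Submission
  imports Defs "HOL-Real_Asymp.Real_Asymp"
begin

text \<open>The empty partition alone refutes convergence. If a block column of \<open>A\<^sub>n\<close> agrees
  with the one of \<open>B\<^sub>n\<close>, then \<open>F\<close> divides the characteristic polynomial of \<open>A\<^sub>n\<close> and
  the partition is nonempty. The block columns are independent and each is unperturbed with
  probability about \<open>1 / n\<close>, so the probability of the empty partition has limes superior at
  most \<open>exp (- 1 / d)\<close>. For \<open>d \<ge> 2\<close> this is smaller than \<open>1 - x - x\<^sup>2\<close> with
  \<open>x = p\<^sup>-\<^sup>d\<close>, which is a lower bound of \<open>\<Prod>\<^sub>l (1 - x\<^sup>l)\<close> by truncating Euler's
  pentagonal number series. For \<open>d = 1\<close> unperturbed rows count as well, and a second order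
  Bonferroni inequality improves \<open>exp (- 1)\<close> to \<open>exp (- 1) / 2\<close>.

  Since the partitions are picked by a choice operator, the rational canonical form has to be
  shown to exist. A block \<open>C(G\<^sup>k)\<close> is split off by pairing the Krylov space of a column vector
  with the Krylov space of a row vector, both in the \<open>G\<close>-primary part: the Hankel matrix of this
  pairing is invertible, so the annihilator of the row space is an invariant complement.\<close>

subsection \<open>Splitting off an invariant block\<close>

no_notation inner (infix "\<bullet>" 70)

lemma inverse_mat_exists:
  fixes A :: "'a::field mat"
  assumes "A \<in> carrier_mat n n" "det A \<noteq> 0"
  obtains B where "B \<in> carrier_mat n n" "A * B = 1\<^sub>m n" "B * A = 1\<^sub>m n"
  using det_non_zero_imp_unit[OF assms, of "()"] by (auto simp: Units_def ring_mat_def)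

lemma similar_mat_if_intertwined:
  fixes W :: "'a::field mat"
  assumes W: "W \<in> carrier_mat n n" "det W \<noteq> 0"
    and A: "A \<in> carrier_mat n n" and D: "D \<in> carrier_mat n n" and eq: "W * A = D * W"
  shows "similar_mat A D"
proof -
  obtain V where V: "V \<in> carrier_mat n n" "W * V = 1\<^sub>m n" "V * W = 1\<^sub>m n"
    using inverse_mat_exists[OF W] .
  have "V * D * W = V * (W * A)"
    using V W D A by (simp add: eq assoc_mult_mat[of _ n n _ n _ n])
  also have "\<dots> = V * W * A"
    using V(1) W A by (intro assoc_mult_mat[symmetric])
  finally have "A = V * D * W" using V A by simp
  then show ?thesis using V W A D by (intro similar_matI[of _ _ V W n]) auto
qed

text \<open>If \<open>r\<close> exceeded \<open>n\<close>, padding \<open>P\<close> with zero rows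
  would give a singular square matrix \<open>S\<close>, and a kernel vector of \<open>S\<close> is
  one of \<open>P\<close>.\<close>

lemma trivial_kernel_imp_le:
  fixes P :: "'a::field mat"
  assumes P: "P \<in> carrier_mat n r"
    and ker: "\<And>x. x \<in> carrier_vec r \<Longrightarrow> P *\<^sub>v x = 0\<^sub>v n \<Longrightarrow> x = 0\<^sub>v r"
  shows "r \<le> n"
proof (rule ccontr)
  assume "\<not> r \<le> n"
  define S where "S = Matrix.mat r r (\<lambda>(i, j). if i < n then P $$ (i, j) else 0)"
  have S: "S \<in> carrier_mat r r" by (simp add: S_def)
  have "row S (r - 1) = 0\<^sub>v r"
    using \<open>\<not> r \<le> n\<close> by (intro eq_vecI) (auto simp: S_def)
  then have "transpose_mat S *\<^sub>v unit_vec r (r - 1) = 0\<^sub>v r"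
    using \<open>\<not> r \<le> n\<close> S by (intro eq_vecI) (auto simp: S_def)
  then have "det (transpose_mat S) = 0"
    using S \<open>\<not> r \<le> n\<close>
    by (subst det_0_iff_vec_prod_zero[of _ r]) (auto intro!: exI[of _ "unit_vec r (r - 1)"])
  then have "det S = 0" using det_transpose[OF S] by simp
  then obtain v where v: "v \<in> carrier_vec r" "v \<noteq> 0\<^sub>v r" "S *\<^sub>v v = 0\<^sub>v r"
    using det_0_iff_vec_prod_zero[OF S] by auto
  have "P *\<^sub>v v = 0\<^sub>v n"
  proof (rule eq_vecI)
    fix i assume "i < dim_vec (0\<^sub>v n :: 'a vec)"
    then have i: "i < n" by simp
    have "(P *\<^sub>v v) $ i = (S *\<^sub>v v) $ i"
      using P i v(1) \<open>\<not> r \<le> n\<close> by (simp add: S_def scalar_prod_def)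
    then show "(P *\<^sub>v v) $ i = 0\<^sub>v n $ i" using v(3) i \<open>\<not> r \<le> n\<close> by simp
  qed (use P in auto)
  then show False using ker v by blast
qed

text \<open>Induction on the number of rows. A square \<open>P\<close> is invertible; a taller one
  is brought by row operations to a form whose last row is zero, and that row is dropped.\<close>

lemma row_reduce_trivial_kernel:
  fixes P :: "'a::field mat"
  assumes P: "P \<in> carrier_mat n r"
    and ker: "\<And>x. x \<in> carrier_vec r \<Longrightarrow> P *\<^sub>v x = 0\<^sub>v n \<Longrightarrow> x = 0\<^sub>v r"
  shows "\<exists>U\<in>carrier_mat n n. det U \<noteq> 0 \<and>
    U * P = Matrix.mat n r (\<lambda>(i, j). if i = j then 1 else 0)"
  using assms
proof (induction n arbitrary: P)
  case 0
  then show ?case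
    by (intro bexI[of _ "1\<^sub>m 0"]) auto
next
  case (Suc n)
  note P = Suc.prems(1) and ker = Suc.prems(2)
  have r: "r \<le> Suc n" using trivial_kernel_imp_le Suc.prems by blast
  show ?case
  proof (cases "r = Suc n")
    case True
    have "det P \<noteq> 0"
      using det_0_iff_vec_prod_zero[of P r] P ker True by auto
    then obtain U where U: "U \<in> carrier_mat (Suc n) (Suc n)" "P * U = 1\<^sub>m (Suc n)" "U * P = 1\<^sub>m (Suc n)"
      using inverse_mat_exists[of P "Suc n"] P True by auto
    have "det U * det P = 1"
      using det_mult[of U "Suc n" P] U P True by simp
    then show ?thesis using U True
      by (intro bexI[of _ U]) (auto simp: one_mat_def)
  next
    case False
    \<comment> \<open>Zero columns fill \<open>P\<close> up to a square matrix for Gauss-Jordan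
      elimination. The padding column \<open>n\<close> stays zero, so the reduced matrix is not the
      identity and, being in row echelon form, ends in a zero row.\<close>
    define S where "S = Matrix.mat (Suc n) (Suc n) (\<lambda>(i, j). if j < r then P $$ (i, j) else 0)"
    have S: "S \<in> carrier_mat (Suc n) (Suc n)" by (simp add: S_def)
    obtain S' B' where g: "gauss_jordan S (0\<^sub>m (Suc n) 0) = (S', B')" by force
    obtain U0 where "U0 \<in> Units (ring_mat TYPE('a) (Suc n) ())" and S': "S' = U0 * S"
      using gauss_jordan_transform[OF S _ g, of 0 "()"] by auto
    then have U0: "U0 \<in> carrier_mat (Suc n) (Suc n)" and dU0: "det U0 \<noteq> 0"
      using unit_imp_det_non_zero by (auto simp: Units_def ring_mat_def)
    have S'c: "S' \<in> carrier_mat (Suc n) (Suc n)" using U0 S S' by simp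
    have "col S n = 0\<^sub>v (Suc n)"
      using False r by (intro eq_vecI) (auto simp: S_def)
    then have "S' $$ (n, n) = 0"
      using U0 S by (simp add: S' scalar_prod_def)
    then have "S' \<noteq> 1\<^sub>m (Suc n)" by auto
    then have last: "row S' n = 0\<^sub>v (Suc n)"
      using row_echelon_form_imp_1_or_0_row[OF S'c gauss_jordan_row_echelon[OF S g]] by auto
    define P0 where "P0 = U0 * P"
    have P0: "P0 \<in> carrier_mat (Suc n) r" using U0 P by (simp add: P0_def)
    have P0n: "P0 $$ (n, j) = 0" if "j < r" for j
    proof -
      have "col S j = col P j" using that r P by (intro eq_vecI) (auto simp: S_def)
      then have "P0 $$ (n, j) = S' $$ (n, j)"
        using that r P S U0 by (simp add: P0_def S')
      also have "\<dots> = row S' n $ j" using that r S'c by simp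
      finally show ?thesis using last that r by simp
    qed
    define P1 where "P1 = Matrix.mat n r (\<lambda>(i, j). P0 $$ (i, j))"
    have P1: "P1 \<in> carrier_mat n r" by (simp add: P1_def)
    have "x = 0\<^sub>v r" if x: "x \<in> carrier_vec r" "P1 *\<^sub>v x = 0\<^sub>v n" for x
    proof -
      have "(P0 *\<^sub>v x) $ i = 0" if "i < Suc n" for i
      proof (cases "i = n")
        case True
        then show ?thesis using P0 x(1) P0n by (simp add: scalar_prod_def)
      next
        case False
        then have i: "i < n" using that by simp
        have "(P0 *\<^sub>v x) $ i = (P1 *\<^sub>v x) $ i"
          using P0 x(1) i by (simp add: scalar_prod_def P1_def)
        then show ?thesis using x(2) i by simp
      qed
      then have "U0 *\<^sub>v (P *\<^sub>v x) = 0\<^sub>v (Suc n)"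
        using P0 U0 P x(1) by (intro eq_vecI) (auto simp: P0_def assoc_mult_mat_vec[of _ "Suc n" "Suc n" _ r])
      moreover have "P *\<^sub>v x \<in> carrier_vec (Suc n)" using P x by simp
      ultimately have "P *\<^sub>v x = 0\<^sub>v (Suc n)"
        using det_0_iff_vec_prod_zero[OF U0] dU0 by auto
      then show ?thesis using ker x by blast
    qed
    from Suc.IH[OF P1 this] obtain U1 where U1: "U1 \<in> carrier_mat n n" "det U1 \<noteq> 0"
      and U1P: "U1 * P1 = Matrix.mat n r (\<lambda>(i, j). if i = j then 1 else 0)" by auto
    \<comment> \<open>\<open>V\<close> applies the inductive transformation to the first
      \<open>n\<close> rows and fixes the zero row.\<close>
    define V where "V = four_block_mat U1 (0\<^sub>m n 1) (0\<^sub>m 1 n) (1\<^sub>m 1)"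
    have V: "V \<in> carrier_mat (Suc n) (Suc n)"
      using U1 four_block_carrier_mat[of U1 n n "1\<^sub>m 1" 1 1] by (simp add: V_def)
    have dV: "det V = det U1"
      using U1 by (simp add: V_def det_four_block_mat_lower_left_zero[of _ n _ 1])
    have P0_split: "P0 = four_block_mat P1 (0\<^sub>m n 0) (0\<^sub>m 1 r) (0\<^sub>m 1 0)"
      using P0 P0n by (intro eq_matI) (auto simp: P1_def less_Suc_eq)
    have "V * P0 = four_block_mat (U1 * P1) (0\<^sub>m n 0) (0\<^sub>m 1 r) (0\<^sub>m 1 0)"
      unfolding V_def P0_split
      using U1 P1 by (subst mult_four_block_mat[of _ n n _ 1 _ 1 _ _ r _ 0]) auto
    also have "\<dots> = Matrix.mat (Suc n) r (\<lambda>(i, j). if i = j then 1 else 0)"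
      unfolding U1P using r False by (intro eq_matI) auto
    finally have "(V * U0) * P = Matrix.mat (Suc n) r (\<lambda>(i, j). if i = j then 1 else 0)"
      using V U0 P by (simp add: P0_def assoc_mult_mat[of _ "Suc n" "Suc n" _ "Suc n" _ r])
    moreover have "det (V * U0) \<noteq> 0" using V U0 dV dU0 U1 by (simp add: det_mult[of _ "Suc n"])
    ultimately show ?thesis using V U0 by (intro bexI[of _ "V * U0"]) auto
  qed
qed

text \<open>Row reduction \<open>U\<close> of \<open>P\<close> makes \<open>A\<close> block upper triangular; replacing the first \<open>r\<close>
  rows of \<open>U\<close> by \<open>Q\<close> keeps the change of basis invertible and clears the upper right block.\<close>

lemma similar_mat_split:
  fixes A :: "'a::field mat"
  assumes A: "A \<in> carrier_mat n n" and P: "P \<in> carrier_mat n r" and Q: "Q \<in> carrier_mat r n"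
    and X: "X \<in> carrier_mat r r" and C: "C \<in> carrier_mat r r"
    and AP: "A * P = P * X" and QA: "Q * A = C * Q" and QP: "det (Q * P) \<noteq> 0"
  obtains m Z where "n = r + m" "Z \<in> carrier_mat m m"
    "similar_mat A (four_block_mat C (0\<^sub>m r m) (0\<^sub>m m r) Z)"
proof -
  have ker: "x = 0\<^sub>v r" if x: "x \<in> carrier_vec r" "P *\<^sub>v x = 0\<^sub>v n" for x
  proof (rule ccontr)
    assume "x \<noteq> 0\<^sub>v r"
    moreover have "(Q * P) *\<^sub>v x = 0\<^sub>v r"
      using P Q x by (simp add: assoc_mult_mat_vec[of _ r n _ r]) (use Q in auto)
    ultimately show False
      using QP det_0_iff_vec_prod_zero[of "Q * P" r] P Q x by auto
  qed
  define m where "m = n - r"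
  have n: "n = r + m" using trivial_kernel_imp_le[OF P ker] by (simp add: m_def)
  obtain U where U: "U \<in> carrier_mat n n" "det U \<noteq> 0"
    and UP: "U * P = Matrix.mat n r (\<lambda>(i, j). if i = j then 1 else 0)"
    using row_reduce_trivial_kernel[OF P ker] by blast
  obtain V where V: "V \<in> carrier_mat n n" "U * V = 1\<^sub>m n" "V * U = 1\<^sub>m n"
    using inverse_mat_exists[OF U] .
  note assoc = assoc_mult_mat[of _ n n _ n _ n] 
  define E where "E = Matrix.mat n r (\<lambda>(i, j). if i = j then 1 :: 'a else 0)"
  have E: "E \<in> carrier_mat n r" by (simp add: E_def)
  \<comment> \<open>Blocks with zero rows or columns bring rectangular matrices into the format of
    \<open>mult_four_block_mat\<close>.\<close>
  have E_split: "E = four_block_mat (1\<^sub>m r) (0\<^sub>m r 0) (0\<^sub>m m r) (0\<^sub>m m 0)"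
    by (intro eq_matI) (auto simp: E_def n)
  have VE: "V * E = P"
    using V U P by (simp add: E_def flip: UP assoc_mult_mat[of _ n n _ n _ r])
  define A' where "A' = U * A * V"
  have A': "A' \<in> carrier_mat n n" using U A V by (simp add: A'_def)
  have "A' * E = U * (A * (V * E))"
    using U A V E by (simp add: A'_def assoc_mult_mat[of _ n n _ n _ r])
  also have "\<dots> = U * P * X"
    unfolding VE AP using U P X by (simp add: assoc_mult_mat[of _ n n _ r _ r])
  also have "\<dots> = E * X"
    by (simp add: UP E_def)
  finally have A'E: "A' * E = E * X" .
  \<comment> \<open>In the new basis the range of \<open>P\<close> is spanned by the first
    \<open>r\<close> unit vectors, so \<open>A' * E = E * X\<close> forces the lower left block
    \<open>A3\<close> to vanish.\<close>
  obtain A1 A2 A3 Z where split: "split_block A' r r = (A1, A2, A3, Z)"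
    by (metis prod_cases4)
  note A'_split = split_block[OF split, of m m]
  have A'd: "dim_row A' = r + m" "dim_col A' = r + m" using A' n by auto
  have A1: "A1 \<in> carrier_mat r r" "A2 \<in> carrier_mat r m" "A3 \<in> carrier_mat m r" "Z \<in> carrier_mat m m"
    and A'_blocks: "A' = four_block_mat A1 A2 A3 Z"
    using A'_split A'd by auto
  have "A' * E = four_block_mat A1 (0\<^sub>m r 0) A3 (0\<^sub>m m 0)"
    unfolding A'_blocks E_split
    using A1 by (subst mult_four_block_mat[of _ r r _ m _ m _ _ r _ 0]) auto
  moreover have X_split: "X = four_block_mat X (0\<^sub>m r 0) (0\<^sub>m 0 r) (0\<^sub>m 0 0)"
    using X by (intro eq_matI) auto
  have "E * X = four_block_mat X (0\<^sub>m r 0) (0\<^sub>m m r) (0\<^sub>m m 0)"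
    unfolding E_split
    using X by (subst X_split, subst mult_four_block_mat[of _ r r _ 0 _ m _ _ r _ 0]) auto
  ultimately have eq: "four_block_mat A1 (0\<^sub>m r 0) A3 (0\<^sub>m m 0) = four_block_mat X (0\<^sub>m r 0) (0\<^sub>m m r) (0\<^sub>m m 0)"
    using A'E by simp
  have A3: "A3 = 0\<^sub>m m r"
  proof (rule eq_matI)
    fix i j assume "i < dim_row (0\<^sub>m m r :: 'a mat)" "j < dim_col (0\<^sub>m m r :: 'a mat)"
    then show "A3 $$ (i, j) = 0\<^sub>m m r $$ (i, j)"
      using arg_cong[OF eq, of "\<lambda>M. M $$ (r + i, j)"] A1 X by simp
  qed (use A1 in auto)
  \<comment> \<open>In the new basis the left block of \<open>Q\<close> becomes the pairing
    \<open>Q * P\<close>, which is invertible by assumption.\<close>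
  define Q' where "Q' = Q * V"
  have Q': "Q' \<in> carrier_mat r n" using Q V by (simp add: Q'_def)
  define Q1 where "Q1 = Matrix.mat r r (\<lambda>(i, j). Q' $$ (i, j))"
  define Q2 where "Q2 = Matrix.mat r m (\<lambda>(i, j). Q' $$ (i, r + j))"
  have Q12: "Q1 \<in> carrier_mat r r" "Q2 \<in> carrier_mat r m" by (simp_all add: Q1_def Q2_def)
  have Q'_split: "Q' = four_block_mat Q1 Q2 (0\<^sub>m 0 r) (0\<^sub>m 0 m)"
    using Q' n by (intro eq_matI) (auto simp: Q1_def Q2_def)
  have "Q' * E = four_block_mat Q1 (0\<^sub>m r 0) (0\<^sub>m 0 r) (0\<^sub>m 0 0)"
    unfolding Q'_split E_split
    using Q12 by (subst mult_four_block_mat[of _ r r _ m _ 0 _ _ r _ 0]) auto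
  also have "\<dots> = Q1" using Q12 by (intro eq_matI) auto
  finally have "Q1 = Q * P"
    using Q V E by (simp add: Q'_def VE assoc_mult_mat[of _ r n _ n _ r])
  then have dQ1: "det Q1 \<noteq> 0" using QP by simp
  have "Q' * A' = Q * A * V"
  proof -
    have "Q' * A' = Q * (V * (U * A * V))"
      using Q V U A by (simp add: Q'_def A'_def assoc_mult_mat[of _ r n _ n _ n])
    also have "V * (U * A * V) = V * U * A * V"
      using V(1) U A by (simp add: assoc)
    finally show ?thesis using Q V A by (simp add: assoc_mult_mat[of _ r n _ n _ n])
  qed
  then have Q'A': "Q' * A' = C * Q'"
    using Q C V by (simp add: QA Q'_def assoc_mult_mat[of _ r r _ n _ n])
  have Q'A'_l: "Q' * A' = four_block_mat (Q1 * A1) (Q1 * A2 + Q2 * Z) (0\<^sub>m 0 r) (0\<^sub>m 0 m)"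
    unfolding Q'_split A'_blocks A3
    using A1 Q12 by (subst mult_four_block_mat[of _ r r _ m _ 0 _ _ r _ m]) auto
  have C_split: "C = four_block_mat C (0\<^sub>m r 0) (0\<^sub>m 0 r) (0\<^sub>m 0 0)"
    using C by (intro eq_matI) auto
  have Q'A'_r: "C * Q' = four_block_mat (C * Q1) (C * Q2) (0\<^sub>m 0 r) (0\<^sub>m 0 m)"
    unfolding Q'_split
    using C Q12 by (subst C_split, subst mult_four_block_mat[of _ r r _ 0 _ 0 _ _ r _ m]) auto
  note eq = Q'A'[unfolded Q'A'_l Q'A'_r]
  have eq1: "Q1 * A1 = C * Q1"
  proof (rule eq_matI)
    fix i j assume "i < dim_row (C * Q1)" "j < dim_col (C * Q1)"
    then show "(Q1 * A1) $$ (i, j) = (C * Q1) $$ (i, j)"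
      using arg_cong[OF eq, of "\<lambda>M. M $$ (i, j)"] A1 Q12 C by simp
  qed (use A1 Q12 C in auto)
  have eq2: "Q1 * A2 + Q2 * Z = C * Q2"
  proof (rule eq_matI)
    fix i j assume "i < dim_row (C * Q2)" "j < dim_col (C * Q2)"
    then show "(Q1 * A2 + Q2 * Z) $$ (i, j) = (C * Q2) $$ (i, j)"
      using arg_cong[OF eq, of "\<lambda>M. M $$ (i, r + j)"] A1 Q12 C by simp
  qed (use A1 Q12 C in auto)
  \<comment> \<open>\<open>T\<close> is block triangular with diagonal blocks \<open>Q1\<close> and
    the identity, hence invertible. The upper half of \<open>T * A' = D * T\<close> is
    \<open>eq1\<close> together with \<open>eq2\<close>; the lower half is
    \<open>A3 = 0\<close>.\<close>
  define T where "T = four_block_mat Q1 Q2 (0\<^sub>m m r) (1\<^sub>m m)"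
  define D where "D = four_block_mat C (0\<^sub>m r m) (0\<^sub>m m r) Z"
  have T: "T \<in> carrier_mat n n" and D: "D \<in> carrier_mat n n"
    using Q12 C A1 n by (auto simp: T_def D_def)
  have "T * A' = four_block_mat (C * Q1) (C * Q2) (0\<^sub>m m r) Z"
    unfolding T_def A'_blocks A3 eq1[symmetric] eq2[symmetric]
    using A1 Q12 by (subst mult_four_block_mat[of _ r r _ m _ m _ _ r _ m]) auto
  also have "\<dots> = D * T"
    unfolding T_def D_def
    using A1 Q12 C by (subst mult_four_block_mat[of _ r r _ m _ m _ _ r _ m]) auto
  finally have TA': "T * A' = D * T" .
  have "(T * U) * A = T * (A' * U)"
    using T U A V by (simp add: A'_def assoc)
  also have "\<dots> = D * (T * U)"
    using T U A' D by (simp add: TA' assoc flip: assoc_mult_mat[of T n n A' n U n])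
  finally have "T * U * A = D * (T * U)" .
  moreover have "det (T * U) \<noteq> 0"
    using T U dQ1 Q12 by (simp add: det_mult[of _ n] T_def det_four_block_mat_lower_left_zero[of _ r _ m])
  ultimately have "similar_mat A D"
    using T U A D by (intro similar_mat_if_intertwined[of "T * U" n]) auto
  then show ?thesis using that n A1 unfolding D_def by blast
qed

subsection \<open>Polynomials in a matrix\<close>

text \<open>Horner's scheme for the value of \<open>f\<close> at the matrix
  \<open>A\<close>.\<close>

definition poly_mat :: "'a::comm_ring_1 mat \<Rightarrow> 'a poly \<Rightarrow> 'a mat" where
  "poly_mat A f = fold_coeffs (\<lambda>a B. a \<cdot>\<^sub>m 1\<^sub>m (dim_row A) + A * B) f (0\<^sub>m (dim_row A) (dim_row A))"

context
  fixes A :: "'a::comm_ring_1 mat" and n :: nat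
  assumes A [simp]: "A \<in> carrier_mat n n"
begin

lemma A_dim [simp]: "dim_row A = n" "dim_col A = n"
  using carrier_matD[OF A] .

lemma poly_mat_0 [simp]: "poly_mat A 0 = 0\<^sub>m n n"
  using A by (simp add: poly_mat_def)

lemma poly_mat_pCons [simp]: "poly_mat A (pCons a f) = a \<cdot>\<^sub>m 1\<^sub>m n + A * poly_mat A f"
proof (cases "a = 0 \<and> f = 0")
  case True
  then have "poly_mat A (pCons a f) = 0\<^sub>m n n" using A by (simp add: poly_mat_def)
  moreover have "a \<cdot>\<^sub>m 1\<^sub>m n + A * poly_mat A f = 0\<^sub>m n n"
    using True A by (simp add: poly_mat_def) (intro eq_matI; simp)
  ultimately show ?thesis by simp
next
  case False
  then show ?thesis using A by (cases "a = 0") (auto simp: poly_mat_def)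
qed

lemma poly_mat_carrier [simp]: "poly_mat A f \<in> carrier_mat n n"
  by (induction f) auto

lemma poly_mat_dim [simp]: "dim_row (poly_mat A f) = n" "dim_col (poly_mat A f) = n"
  using carrier_matD[OF poly_mat_carrier[of f]] .

lemma poly_mat_1 [simp]: "poly_mat A 1 = 1\<^sub>m n"
  using A unfolding one_pCons by (simp del: A) (intro eq_matI; simp)

lemma poly_mat_add: "poly_mat A (f + g) = poly_mat A f + poly_mat A g"
proof (induction f arbitrary: g)
  case 0
  then show ?case by simp
next
  case (pCons a f)
  obtain b g' where g: "g = pCons b g'" by (cases g)
  have "poly_mat A (pCons a f + g) = (a + b) \<cdot>\<^sub>m 1\<^sub>m n + A * (poly_mat A f + poly_mat A g')"
    by (simp add: g pCons.IH)
  also have "\<dots> = (a \<cdot>\<^sub>m 1\<^sub>m n + b \<cdot>\<^sub>m 1\<^sub>m n) + (A * poly_mat A f + A * poly_mat A g')"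
    by (simp add: mult_add_distrib_mat[of _ n n _ n] add_smult_distrib_right_mat[of _ n n])
  also have "\<dots> = poly_mat A (pCons a f) + poly_mat A g"
    using A by (intro eq_matI) (simp_all add: g)
  finally show ?case .
qed

lemma poly_mat_smult: "poly_mat A (Polynomial.smult c f) = c \<cdot>\<^sub>m poly_mat A f"
proof (induction f)
  case 0
  then show ?case by simp
next
  case (pCons a f)
  have "poly_mat A (Polynomial.smult c (pCons a f)) = (c * a) \<cdot>\<^sub>m 1\<^sub>m n + c \<cdot>\<^sub>m (A * poly_mat A f)"
    by (simp add: pCons.IH mult_smult_distrib[of _ n n _ n])
  also have "\<dots> = c \<cdot>\<^sub>m poly_mat A (pCons a f)"
    by (intro eq_matI) (simp_all add: algebra_simps)
  finally show ?case .
qed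

lemma poly_mat_mult: "poly_mat A (f * g) = poly_mat A f * poly_mat A g"
proof (induction f)
  case 0
  then show ?case by simp
next
  case (pCons a f)
  have "poly_mat A (pCons a f * g) = a \<cdot>\<^sub>m poly_mat A g + (0 \<cdot>\<^sub>m 1\<^sub>m n + A * (poly_mat A f * poly_mat A g))"
    by (simp add: poly_mat_add poly_mat_smult pCons.IH)
  also have "\<dots> = a \<cdot>\<^sub>m poly_mat A g + A * (poly_mat A f * poly_mat A g)"
    by (intro eq_matI) simp_all
  also have "\<dots> = poly_mat A (pCons a f) * poly_mat A g"
  proof -
    have "A * poly_mat A f \<in> carrier_mat n n" using A by (rule mult_carrier_mat) simp
    then have "poly_mat A (pCons a f) * poly_mat A g =
        a \<cdot>\<^sub>m 1\<^sub>m n * poly_mat A g + A * poly_mat A f * poly_mat A g"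
      by (simp add: add_mult_distrib_mat[of _ n n _ _ n])
    also have "a \<cdot>\<^sub>m 1\<^sub>m n * poly_mat A g = a \<cdot>\<^sub>m poly_mat A g"
      by (simp add: mult_smult_assoc_mat[of _ n n _ n])
    also have "A * poly_mat A f * poly_mat A g = A * (poly_mat A f * poly_mat A g)"
      by (rule assoc_mult_mat[of _ n n _ n _ n]) simp_all
    finally show ?thesis by simp
  qed
  finally show ?case .
qed

lemma poly_mat_X: "poly_mat A [:0, 1:] = A"
proof -
  have "poly_mat A [:0, 1:] = 0 \<cdot>\<^sub>m 1\<^sub>m n + A * (1 \<cdot>\<^sub>m 1\<^sub>m n + A * 0\<^sub>m n n)"
    by simp
  also have "1 \<cdot>\<^sub>m 1\<^sub>m n + A * 0\<^sub>m n n = 1\<^sub>m n" by (intro eq_matI) simp_all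
  also have "0 \<cdot>\<^sub>m 1\<^sub>m n + A * 1\<^sub>m n = A" using A by (intro eq_matI) simp_all
  finally show ?thesis .
qed

lemma poly_mat_uminus: "poly_mat A (- f) = - poly_mat A f"
  using poly_mat_smult[of "- 1" f] by simp (intro eq_matI; simp)

lemma poly_mat_diff: "poly_mat A (f - g) = poly_mat A f - poly_mat A g"
proof -
  have "poly_mat A (f - g) = poly_mat A f + - poly_mat A g"
    using poly_mat_add[of f "- g"] by (simp add: poly_mat_uminus)
  then show ?thesis by (simp add: minus_add_uminus_mat[of _ n n])
qed

lemma poly_mat_sum_index:
  assumes "finite I" "i < n" "j < n"
  shows "poly_mat A (\<Sum>l\<in>I. f l) $$ (i, j) = (\<Sum>l\<in>I. poly_mat A (f l) $$ (i, j))"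
  using assms(1) by (induction I rule: finite_induct) (use assms in \<open>auto simp: poly_mat_add\<close>)

end

section \<open>Ideals of polynomials, minimal polynomials and irreducible factors\<close>

lemma finite_carrier_mat: "finite (carrier_mat nr nc :: 'a::finite mat set)"
proof (rule finite_subset)
  show "carrier_mat nr nc \<subseteq> (\<lambda>f. Matrix.mat nr nc f) ` (PiE ({..<nr} \<times> {..<nc}) (\<lambda>_. UNIV :: 'a set))"
  proof
    fix B :: "'a mat" assume "B \<in> carrier_mat nr nc"
    then have "B = Matrix.mat nr nc (restrict (\<lambda>ij. B $$ ij) ({..<nr} \<times> {..<nc}))"
      by (intro eq_matI) auto
    then show "B \<in> (\<lambda>f. Matrix.mat nr nc f) ` (PiE ({..<nr} \<times> {..<nc}) (\<lambda>_. UNIV :: 'a set))"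
      unfolding image_iff by (intro bexI[of _ "restrict (\<lambda>ij. B $$ ij) ({..<nr} \<times> {..<nc})"]) simp_all
  qed
qed (intro finite_imageI finite_PiE; simp)

text \<open>A nonzero element \<open>e\<close> of least degree generates the ideal: the remainder of
  any member modulo \<open>e\<close> stays in \<open>I\<close> and has smaller degree unless it is
  zero.\<close>

lemma poly_ideal_generator:
  fixes I :: "'a::field poly set"
  assumes m: "m \<in> I" "m \<noteq> 0"
    and I_mult: "\<And>g h. h \<in> I \<Longrightarrow> g * h \<in> I" and I_diff: "\<And>g h. g \<in> I \<Longrightarrow> h \<in> I \<Longrightarrow> g - h \<in> I"
  shows "\<exists>e. e \<noteq> 0 \<and> (\<forall>h. h \<in> I \<longleftrightarrow> e dvd h)"
proof -
  obtain e where e: "e \<in> I" "e \<noteq> 0" and e_min: "\<And>h. h \<in> I \<Longrightarrow> h \<noteq> 0 \<Longrightarrow> degree e \<le> degree h"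
    using ex_has_least_nat[of "\<lambda>h. h \<in> I \<and> h \<noteq> 0" m degree] m by blast
  have "e dvd h" if "h \<in> I" for h
  proof -
    have "h mod e \<in> I"
      using I_diff[OF that I_mult[OF e(1), of "h div e"]] by (simp add: minus_div_mult_eq_mod)
    then have "h mod e = 0"
      using e_min[of "h mod e"] degree_mod_less[OF e(2), of h] by fastforce
    then show ?thesis by (simp add: mod_eq_0_iff_dvd)
  qed
  moreover have "h \<in> I" if "e dvd h" for h
  proof -
    from that obtain g where "h = e * g" ..
    then show ?thesis using I_mult[OF e(1), of g] by (simp add: mult.commute)
  qed
  ultimately show ?thesis using e(2) by blast
qed

text \<open>Over a finite field there are finitely many matrices of size \<open>n\<close>, so two
  powers of \<open>A\<close> coincide. The difference of the two monomials is a nonzero member of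
  the annihilating ideal, which is principal.\<close>

lemma min_poly_exists:
  fixes A :: "'k::{field, finite} mat"
  assumes A: "A \<in> carrier_mat n n"
  shows "\<exists>m. m \<noteq> 0 \<and> (\<forall>f. poly_mat A f = 0\<^sub>m n n \<longleftrightarrow> m dvd f)"
proof -
  have "\<not> inj (\<lambda>l. poly_mat A (monom 1 l))"
  proof
    assume "inj (\<lambda>l. poly_mat A (monom 1 l))"
    then have "infinite (range (\<lambda>l. poly_mat A (monom 1 l)))"
      by (simp add: finite_image_iff)
    moreover have "range (\<lambda>l. poly_mat A (monom 1 l)) \<subseteq> carrier_mat n n"
      using A by auto
    ultimately show False using finite_carrier_mat finite_subset by blast
  qed
  then obtain k l where "k \<noteq> l" "poly_mat A (monom 1 k) = poly_mat A (monom 1 l)"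
    by (auto simp: inj_def)
  let ?I = "{f. poly_mat A f = 0\<^sub>m n n}"
  have I: "monom 1 k - monom 1 l \<in> ?I"
    using A \<open>poly_mat A (monom 1 k) = poly_mat A (monom 1 l)\<close> by (simp add: poly_mat_diff[of _ n])
  have nz: "monom 1 k - monom 1 l \<noteq> (0 :: 'k poly)"
    using \<open>k \<noteq> l\<close> by (simp add: monom_eq_iff')
  have I_mult: "g * h \<in> ?I" if "h \<in> ?I" for g h
    using that right_mult_zero_mat[OF poly_mat_carrier[OF A, of g]] by (simp add: poly_mat_mult[OF A])
  have I_diff: "g - h \<in> ?I" if "g \<in> ?I" "h \<in> ?I" for g h
    using that by (simp add: poly_mat_diff[OF A])
  obtain m where m: "m \<noteq> 0" "\<And>f. f \<in> ?I \<longleftrightarrow> m dvd f"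
    using poly_ideal_generator[OF I nz I_mult I_diff] by blast
  then show ?thesis by (intro exI[of _ m]) simp
qed

text \<open>A nonconstant divisor of least degree cannot be split further; it only has to be made
  monic.\<close>

lemma monic_irreducible_factor_exists:
  fixes m :: "'a::field poly"
  assumes "degree m \<ge> 1"
  obtains G where "lead_coeff G = 1" "irreducible G" "G dvd m"
proof -
  obtain G where G: "G dvd m" "degree G \<ge> 1"
    and min: "\<And>H. H dvd m \<Longrightarrow> degree H \<ge> 1 \<Longrightarrow> degree G \<le> degree H"
    using ex_has_least_nat[of "\<lambda>G. G dvd m \<and> degree G \<ge> 1" m degree] assms by auto
  have "G \<noteq> 0" using G by auto
  have "irreducible G"
  proof (rule irreducibleI)
    fix a b assume ab: "G = a * b"
    with \<open>G \<noteq> 0\<close> have nz: "a \<noteq> 0" "b \<noteq> 0" by auto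
    then have deg: "degree G = degree a + degree b" using ab by (simp add: degree_mult_eq)
    have "degree a = 0 \<or> degree b = 0"
    proof -
      have "a dvd m" "b dvd m" using ab G(1) dvd_mult_left dvd_mult_right by blast+
      then show ?thesis using min[of a] min[of b] deg by linarith
    qed
    then show "a dvd 1 \<or> b dvd 1" using nz by (auto simp: is_unit_iff_degree)
  qed (use G \<open>G \<noteq> 0\<close> in \<open>auto simp: is_unit_iff_degree\<close>)
  then have "irreducible (Polynomial.smult (1 / lead_coeff G) G)"
    using \<open>G \<noteq> 0\<close> irreducible_mult_unit_left[of "[:1 / lead_coeff G:]" G]
    by (simp add: is_unit_const_poly_iff)
  moreover have "Polynomial.smult (1 / lead_coeff G) G dvd m"
    using G(1) \<open>G \<noteq> 0\<close> by (simp add: smult_dvd_iff)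
  moreover have "lead_coeff (Polynomial.smult (1 / lead_coeff G) G) = 1"
    using \<open>G \<noteq> 0\<close> by simp
  ultimately show ?thesis using that by blast
qed

lemma split_off_irreducible_power:
  fixes m G :: "'a::field poly"
  assumes "m \<noteq> 0" "irreducible G" "G dvd m"
  shows "\<exists>k h. m = G ^ Suc k * h \<and> \<not> G dvd h"
  using assms(1,3)
proof (induction "degree m" arbitrary: m rule: less_induct)
  case less
  obtain m' where m': "m = G * m'" using less.prems(2) by (elim dvdE)
  show ?case
  proof (cases "G dvd m'")
    case True
    have "G \<noteq> 0" "degree G \<noteq> 0"
      using assms(2) irreducible_not_unit[OF assms(2)] by (auto simp: is_unit_iff_degree)
    then have "degree m' < degree m" "m' \<noteq> 0"
      using less.prems(1) m' by (auto simp: degree_mult_eq)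
    with less.hyps True obtain k h where "m' = G ^ Suc k * h" "\<not> G dvd h" by blast
    then show ?thesis using m' by (intro exI[of _ "Suc k"] exI[of _ h]) (simp add: mult.assoc)
  next
    case False
    then show ?thesis using m' by (intro exI[of _ 0] exI[of _ m']) simp
  qed
qed

text \<open>If the cofactor of \<open>f\<close> contains \<open>G\<close>, one factor
  \<open>G\<close> cancels; otherwise all copies of \<open>G\<close> sit in
  \<open>f\<close>.\<close>

lemma dvd_prime_elem_power_cases:
  fixes G :: "'a::algebraic_semidom"
  assumes "prime_elem G" "f dvd G ^ Suc k"
  shows "f dvd G ^ k \<or> G ^ Suc k dvd f"
proof -
  obtain c where c: "G ^ Suc k = f * c" using assms(2) by (elim dvdE)
  show ?thesis
  proof (cases "G dvd c")
    case True
    then obtain c' where "c = G * c'" by (elim dvdE)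
    then have "G * G ^ k = G * (f * c')" using c by (simp add: mult_ac)
    then have "G ^ k = f * c'" using assms(1) by simp
    then show ?thesis by simp
  next
    case False
    then have "\<not> G ^ Suc 0 dvd c" by simp
    moreover have "G ^ Suc k dvd f * c" using c by simp
    ultimately have "G ^ Suc k dvd f"
      using prime_elem_power_dvd_cases[of G "Suc k" f c "Suc k" "Suc 0"] assms(1) by auto
    then show ?thesis by simp
  qed
qed

text \<open>The polynomials \<open>f\<close> such that \<open>\<phi>\<close> kills the ideal generated by \<open>f\<close> form an ideal,
  whose generator divides \<open>G ^ Suc k\<close> but not \<open>G ^ k\<close>.\<close>

lemma nondegenerate_functional:
  fixes \<phi> :: "'a::field poly \<Rightarrow> 'a" and G :: "'a poly"
  assumes add: "\<And>f g. \<phi> (f + g) = \<phi> f + \<phi> g" and smult: "\<And>c f. \<phi> (Polynomial.smult c f) = c * \<phi> f"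
    and G: "irreducible G" and kill: "\<And>g. \<phi> (g * G ^ Suc k) = 0" and nz: "\<phi> (G ^ k) \<noteq> 0"
    and f: "degree f < degree (G ^ Suc k)" and f_kill: "\<And>l. l < degree (G ^ Suc k) \<Longrightarrow> \<phi> (monom 1 l * f) = 0"
  shows "f = 0"
proof -
  let ?m = "G ^ Suc k" and ?r = "degree (G ^ Suc k)"
  have "?m \<noteq> 0" using G by auto
  have zero: "\<phi> 0 = 0" using smult[of 0 0] by simp
  have sum: "\<phi> (sum h I) = (\<Sum>i\<in>I. \<phi> (h i))" for h and I :: "nat set"
    by (induction I rule: infinite_finite_induct) (auto simp: zero add)
  \<comment> \<open>Reducing \<open>g\<close> modulo \<open>?m\<close> leaves a combination of
    monomials of degree below \<open>?r\<close>, so the finitely many conditions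
    \<open>f_kill\<close> extend to all multiples of \<open>f\<close>.\<close>
  have f_ideal: "\<phi> (g * f) = 0" for g
  proof -
    define g' where "g' = g mod ?m"
    have deg: "g' = 0 \<or> degree g' < ?r" using degree_mod_less[OF \<open>?m \<noteq> 0\<close>, of g] by (auto simp: g'_def)
    have small: "\<phi> (g' * f) = 0"
    proof (cases "g' = 0")
      case False
      have "g' * f = (\<Sum>l\<le>degree g'. Polynomial.smult (coeff g' l) (monom 1 l * f))"
        by (subst (1) poly_as_sum_of_monoms[of g', symmetric])
          (simp add: sum_distrib_right smult_monom flip: mult_smult_left)
      then show ?thesis
        using deg False f_kill by (simp add: sum smult)
    qed (simp add: zero)
    have "g * f = (g div ?m * f) * ?m + g' * f"
    proof -
      have "g * f = (g div ?m * ?m + g') * f" by (simp only: g'_def div_mult_mod_eq)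
      then show ?thesis by (simp only: distrib_left distrib_right mult_ac)
    qed
    then show ?thesis using small kill by (simp add: add)
  qed
  define I where "I = {f. \<forall>g. \<phi> (g * f) = 0}"
  have I: "?m \<in> I" "f \<in> I" using kill f_ideal by (auto simp: I_def)
  have I_mult: "g * h \<in> I" if "h \<in> I" for g h
    using that by (auto simp: I_def simp flip: mult.assoc)
  have I_diff: "g - h \<in> I" if "g \<in> I" "h \<in> I" for g h
  proof -
    have "\<phi> (c * (g - h)) = \<phi> (c * g) + \<phi> (Polynomial.smult (- 1) (c * h))" for c
      by (simp add: algebra_simps flip: add)
    then show ?thesis using that by (simp add: I_def smult del: smult_minus_left)
  qed
  obtain e where "e \<noteq> 0" and e: "\<And>h. h \<in> I \<longleftrightarrow> e dvd h"
    using poly_ideal_generator[OF I(1) \<open>?m \<noteq> 0\<close> I_mult I_diff] by blast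
  have "\<not> e dvd G ^ k"
  proof
    assume "e dvd G ^ k"
    then have "\<phi> (1 * G ^ k) = 0" unfolding e[symmetric] I_def by blast
    then show False using nz by simp
  qed
  then have "?m dvd e"
    using dvd_prime_elem_power_cases[OF field_poly_irreducible_imp_prime[OF G], of e k] I(1)[unfolded e] by simp
  then have "?m dvd f" using I(2)[unfolded e] dvd_trans by blast
  then show ?thesis using f dvd_imp_degree_le[of ?m f] by auto
qed

subsection \<open>The rational canonical form\<close>

lemma companion_mat_carrier [simp]: "companion_mat f \<in> carrier_mat (degree f) (degree f)"
  by (simp add: companion_mat_def)

lemma companion_mat_dim [simp]:
  "dim_row (companion_mat f) = degree f" "dim_col (companion_mat f) = degree f"
  by (simp_all add: companion_mat_def)

text \<open>A companion matrix acts as the shift of a linear recurrence: each coordinate is replaced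
  by the next one, and the last by the recurrence value. The intertwining relations with the Krylov
  matrices are checked in this form.\<close>

lemma scalar_prod_row_companion_mat:
  assumes "l < degree f" "v \<in> carrier_vec (degree f)"
  shows "row (companion_mat f) l \<bullet> v =
    (if l = degree f - 1 then \<Sum>c<degree f. - coeff f c * v $ c else v $ Suc l)"
proof (cases "l = degree f - 1")
  case True
  then show ?thesis using assms by (simp add: scalar_prod_def companion_mat_def atLeast0LessThan)
next
  case False
  have "row (companion_mat f) l \<bullet> v = (\<Sum>c<degree f. if c = Suc l then v $ c else 0)"
    using assms False by (simp add: scalar_prod_def companion_mat_def atLeast0LessThan if_distrib[of "\<lambda>x. x * _"] cong: if_cong)
  then show ?thesis using assms False by simp
qed

text \<open>Let the minimal polynomial be \<open>m = G ^ Suc k * h\<close> with \<open>h\<close>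
  prime to \<open>G\<close>; then h(A) maps into the \<open>G\<close>-primary part. Take column
  \<open>j\<close> and row \<open>i\<close> of the matrices h(A) A^l for \<open>l\<close> below the
  degree of \<open>G ^ Suc k\<close>. Both families are intertwined with the companion matrix, and
  for suitable \<open>i\<close> and \<open>j\<close> their pairing is nondegenerate, so
  \<open>similar_mat_split\<close> applies.\<close>

lemma similar_mat_companion_split:
  fixes A :: "'k::{field, finite} mat"
  assumes A: "A \<in> carrier_mat n n" and n: "n > 0"
  shows "\<exists>G k s Z. lead_coeff G = 1 \<and> irreducible G \<and> n = degree (G ^ Suc k) + s \<and> Z \<in> carrier_mat s s \<and>
    similar_mat A (four_block_mat (companion_mat (G ^ Suc k)) (0\<^sub>m (degree (G ^ Suc k)) s)
      (0\<^sub>m s (degree (G ^ Suc k))) Z)"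
proof -
  obtain m where m: "m \<noteq> 0" "\<And>f. poly_mat A f = 0\<^sub>m n n \<longleftrightarrow> m dvd f"
    using min_poly_exists[OF A] by blast
  have "\<not> m dvd 1"
  proof
    assume "m dvd 1"
    then have "1\<^sub>m n = (0\<^sub>m n n :: 'k mat)" using m(2)[of 1] A by simp
    then have "1\<^sub>m n $$ (0, 0) = (0\<^sub>m n n $$ (0, 0) :: 'k)" by simp
    then show False using n by simp
  qed
  then have "degree m \<ge> 1" using m(1) by (simp add: is_unit_iff_degree)
  then obtain G where G: "lead_coeff G = 1" "irreducible G" "G dvd m"
    using monic_irreducible_factor_exists by blast
  obtain k h where mk: "m = G ^ Suc k * h" and h: "\<not> G dvd h"
    using split_off_irreducible_power[OF m(1) G(2,3)] by blast
  \<comment> \<open>One copy of \<open>h\<close> goes to the row space and one to the column space.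
    The nonzero entry obtained from this fixes \<open>i\<close> and \<open>j\<close>.\<close>
  have "\<not> m dvd h * h * G ^ k"
  proof
    assume "m dvd h * h * G ^ k"
    then have "(G ^ k * h) * G dvd (G ^ k * h) * h" by (simp add: mk mult_ac)
    moreover have "G ^ k * h \<noteq> 0" using m(1) mk by auto
    ultimately show False using h by (simp add: dvd_mult_cancel_left)
  qed
  then have "poly_mat A (h * h * G ^ k) \<noteq> 0\<^sub>m n n" using m(2) by simp
  then obtain i j where ij: "i < n" "j < n" "poly_mat A (h * h * G ^ k) $$ (i, j) \<noteq> 0"
    using eq_matI[of "poly_mat A (h * h * G ^ k)" "0\<^sub>m n n"] poly_mat_dim[OF A] by auto
  define M where "M = G ^ Suc k"
  define r where "r = degree M"
  have M: "lead_coeff M = 1" unfolding M_def by (rule monic_power[OF G(1)])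
  \<comment> \<open>The values of \<open>\<phi>\<close> on monomials are the entries of the Hankel
    matrix of the pairing, and \<open>R l\<close> is h(A) A^l.\<close>
  define \<phi> where "\<phi> = (\<lambda>f. poly_mat A (h * h * f) $$ (i, j))"
  define R where "R = (\<lambda>l. poly_mat A (h * monom 1 l))"
  have R [simp]: "R l \<in> carrier_mat n n" for l using A by (simp add: R_def)
  have R_dim [simp]: "dim_row (R l) = n" "dim_col (R l) = n" for l using carrier_matD[OF R] by auto
  have X: "poly_mat A (monom 1 (Suc 0)) = A" using poly_mat_X[OF A] by (simp add: monom_altdef)
  have R_Suc: "A * R l = R (Suc l)" "R l * A = R (Suc l)" for l
    using poly_mat_mult[OF A, of "monom 1 (Suc 0)" "h * monom 1 l"] poly_mat_mult[OF A, of "h * monom 1 l" "monom 1 (Suc 0)"]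
    by (simp_all add: R_def X mult_monom mult.assoc mult.left_commute[of "monom 1 (Suc 0)"])
  have R_mult: "(R l * R l') $$ (i, j) = \<phi> (monom 1 (l + l'))" for l l'
  proof -
    have "h * monom 1 l * (h * monom 1 l') = h * h * (monom 1 l * monom 1 l')"
      by (simp only: mult_ac)
    also have "monom 1 l * monom 1 l' = (monom 1 (l + l') :: 'k poly)"
      by (simp add: mult_monom)
    finally have "h * monom 1 l * (h * monom 1 l') = h * h * monom 1 (l + l')" .
    then show ?thesis
      unfolding R_def \<phi>_def poly_mat_mult[OF A, of "h * monom 1 l" "h * monom 1 l'", symmetric] by (simp only:)
  qed
  \<comment> \<open>\<open>h * M\<close> is the minimal polynomial, so the sequence \<open>R\<close>
    obeys the linear recurrence with characteristic polynomial \<open>M\<close>.\<close>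
  have R_rec: "R r $$ (a, b) = (\<Sum>c<r. - coeff M c * R c $$ (a, b))" if ab: "a < n" "b < n" for a b
  proof -
    have "M = (\<Sum>c<r. Polynomial.smult (coeff M c) (monom 1 c)) + monom 1 r"
      using poly_as_sum_of_monoms[of M] M by (simp add: r_def smult_monom flip: lessThan_Suc_atMost)
    then have "h * M = (\<Sum>c<r. Polynomial.smult (coeff M c) (h * monom 1 c)) + h * monom 1 r"
      by (metis (no_types, lifting) distrib_left mult_smult_right sum.cong sum_distrib_left)
    moreover have "poly_mat A (h * M) = 0\<^sub>m n n"
      using m(2)[of "h * M"] mk by (simp add: M_def mult.commute)
    ultimately have "0\<^sub>m n n = poly_mat A ((\<Sum>c<r. Polynomial.smult (coeff M c) (h * monom 1 c)) + h * monom 1 r)"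
      by simp
    from arg_cong[OF this, of "\<lambda>B. B $$ (a, b)"]
    have "0 = (\<Sum>c<r. coeff M c * R c $$ (a, b)) + R r $$ (a, b)"
      using ab A by (simp add: poly_mat_add[OF A] poly_mat_sum_index[OF A] poly_mat_smult[OF A] R_def)
    then show ?thesis by (simp add: sum_negf eq_neg_iff_add_eq_0 add.commute)
  qed
  define P where "P = Matrix.mat n r (\<lambda>(a, l). R l $$ (a, j))"
  define Q where "Q = Matrix.mat r n (\<lambda>(l, b). R l $$ (i, b))"
  define C where "C = companion_mat M"
  have P: "P \<in> carrier_mat n r" and Q: "Q \<in> carrier_mat r n" and C: "C \<in> carrier_mat r r"
    by (simp_all add: P_def Q_def C_def r_def)
  \<comment> \<open>The left side has the shape delivered by
    \<open>scalar_prod_row_companion_mat\<close>; at \<open>l = r - 1\<close> the right side is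
    \<open>R r\<close>, and \<open>R_rec\<close> closes the gap.\<close>
  have rec: "(if l = r - 1 then \<Sum>c<r. - coeff M c * R c $$ (a, b) else R (Suc l) $$ (a, b)) = R (Suc l) $$ (a, b)"
    if "l < r" "a < n" "b < n" for l a b
    using that R_rec[of a b] by (cases "l = r - 1") auto
  have "Q * A = C * Q"
  proof (rule eq_matI)
    fix l b assume "l < dim_row (C * Q)" "b < dim_col (C * Q)"
    then have lb: "l < r" "b < n" using C Q by auto
    have "(Q * A) $$ (l, b) = (R l * A) $$ (i, b)"
      using lb ij A by (simp add: Q_def scalar_prod_def)
    also have "\<dots> = R (Suc l) $$ (i, b)" by (simp add: R_Suc)
    also have "\<dots> = (C * Q) $$ (l, b)"
      using lb ij scalar_prod_row_companion_mat[of l M "col Q b"] rec[of l i b]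
      by (auto simp: C_def r_def Q_def companion_mat_def)
    finally show "(Q * A) $$ (l, b) = (C * Q) $$ (l, b)" .
  qed (use Q A C in auto)
  moreover have "A * P = P * transpose_mat C"
  proof (rule eq_matI)
    fix a l assume "a < dim_row (P * transpose_mat C)" "l < dim_col (P * transpose_mat C)"
    then have al: "a < n" "l < r" using P C by auto
    have "(A * P) $$ (a, l) = (A * R l) $$ (a, j)"
      using al ij A by (simp add: P_def scalar_prod_def)
    also have "\<dots> = R (Suc l) $$ (a, j)" by (simp add: R_Suc)
    also have "\<dots> = row C l \<bullet> row P a"
      using al ij scalar_prod_row_companion_mat[of l M "row P a"] rec[of l a j]
      by (auto simp: C_def r_def P_def)
    also have "\<dots> = (P * transpose_mat C) $$ (a, l)"
      using al P C by (simp add: comm_scalar_prod[of _ r])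
    finally show "(A * P) $$ (a, l) = (P * transpose_mat C) $$ (a, l)" .
  qed (use P A C in auto)
  \<comment> \<open>A kernel vector of the Hankel matrix \<open>Q * P\<close> is the coefficient
    vector of a polynomial \<open>f\<close> of degree below \<open>r\<close> such that
    \<open>\<phi> (monom 1 l * f)\<close> vanishes for all \<open>l < r\<close>. Nondegeneracy of
    \<open>\<phi>\<close> makes \<open>f\<close> zero.\<close>
  moreover have "det (Q * P) \<noteq> 0"
  proof
    assume "det (Q * P) = 0"
    then obtain v where v: "v \<in> carrier_vec r" "v \<noteq> 0\<^sub>v r" "(Q * P) *\<^sub>v v = 0\<^sub>v r"
      using det_0_iff_vec_prod_zero[of "Q * P" r] P Q by auto
    have \<phi>_add: "\<phi> (f + g) = \<phi> f + \<phi> g" and \<phi>_smult: "\<phi> (Polynomial.smult c f) = c * \<phi> f" for f g c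
      using ij A by (simp_all add: \<phi>_def distrib_left poly_mat_add[OF A] poly_mat_smult[OF A])
    have \<phi>_sum: "\<phi> (sum f I) = (\<Sum>l\<in>I. \<phi> (f l))" if "finite I" for f and I :: "nat set"
      using that ij by (simp add: \<phi>_def sum_distrib_left poly_mat_sum_index[OF A])
    define f where "f = (\<Sum>c<r. Polynomial.smult (v $ c) (monom 1 c))"
    have coeff_f: "coeff f c = (if c < r then v $ c else 0)" for c
      by (simp add: f_def coeff_sum if_distrib[of "\<lambda>x. _ * x"] cong: if_cong)
    have "r > 0" using v(1,2) by (cases r) auto
    then have deg: "degree f < r"
      using coeff_f by (intro degree_lessI) auto
    have "f = 0"
    proof (rule nondegenerate_functional[of \<phi> G k])
      show "\<phi> (g * G ^ Suc k) = 0" for g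
        using m(2)[of "h * h * (g * G ^ Suc k)"] ij mk by (simp add: \<phi>_def mult_ac)
      show "\<phi> (G ^ k) \<noteq> 0" using ij by (simp add: \<phi>_def)
      show "degree f < degree (G ^ Suc k)" using deg by (simp add: r_def M_def)
      fix l assume "l < degree (G ^ Suc k)"
      then have l: "l < r" by (simp add: r_def M_def)
      have "\<phi> (monom 1 l * f) = (\<Sum>c<r. \<phi> (monom 1 (l + c)) * v $ c)"
        by (simp add: f_def sum_distrib_left \<phi>_sum \<phi>_smult mult_monom) (simp add: mult.commute)
      also have "\<dots> = (\<Sum>c<r. (Q * P) $$ (l, c) * v $ c)"
        using l ij by (intro sum.cong refl) (simp add: P_def Q_def scalar_prod_def flip: R_mult)
      also have "\<dots> = ((Q * P) *\<^sub>v v) $ l"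
        using l P Q v(1) by (subst index_mult_mat_vec) (auto simp: scalar_prod_def atLeast0LessThan)
      finally show "\<phi> (monom 1 l * f) = 0" using v(3) l by simp
    qed (use \<phi>_add \<phi>_smult G(2) in auto)
    then have "v = 0\<^sub>v r" using coeff_f v(1) by (intro eq_vecI) (auto, metis coeff_0)
    then show False using v(2) by simp
  qed
  ultimately obtain s Z where "n = r + s" "Z \<in> carrier_mat s s"
    "similar_mat A (four_block_mat C (0\<^sub>m r s) (0\<^sub>m s r) Z)"
    using similar_mat_split[OF A P Q _ C, of "transpose_mat C"] C by auto
  then show ?thesis
    using G unfolding C_def r_def M_def by blast
qed

text \<open>The split is iterated on the complement \<open>Z\<close>, which is strictly smaller
  because an irreducible \<open>G\<close> is nonconstant.\<close>

lemma companion_decomposition: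
  fixes A :: "'k::{field, finite} mat"
  assumes "A \<in> carrier_mat n n"
  shows "\<exists>ps. (\<forall>(G, k)\<in>set ps. lead_coeff G = 1 \<and> irreducible G \<and> k > 0) \<and>
    similar_mat A (diag_block_mat (map (\<lambda>(G, k). companion_mat (G ^ k)) ps))"
  using assms
proof (induction n arbitrary: A rule: less_induct)
  case (less n)
  show ?case
  proof (cases "n = 0")
    case True
    then have "A = 0\<^sub>m 0 0" using less.prems by (intro eq_matI) auto
    then show ?thesis
      by (intro exI[of _ "[]"]) (simp add: similar_mat_refl[of _ 0])
  next
    case False
    obtain G k s Z where G: "lead_coeff G = 1" "irreducible G" and n: "n = degree (G ^ Suc k) + s"
      and Z: "Z \<in> carrier_mat s s"
      and sim: "similar_mat A (four_block_mat (companion_mat (G ^ Suc k)) (0\<^sub>m (degree (G ^ Suc k)) s)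
        (0\<^sub>m s (degree (G ^ Suc k))) Z)"
      using similar_mat_companion_split[OF less.prems] False by auto
    have "degree G > 0" using G irreducible_not_unit[of G] by (auto simp: is_unit_iff_degree)
    then have "s < n" using G n by (auto simp: degree_power_eq simp del: power_Suc)
    from less.IH[OF this Z] obtain ps where ps: "\<forall>(G, k)\<in>set ps. lead_coeff G = 1 \<and> irreducible G \<and> k > 0"
      and simZ: "similar_mat Z (diag_block_mat (map (\<lambda>(G, k). companion_mat (G ^ k)) ps))" by blast
    let ?D = "diag_block_mat (map (\<lambda>(G, k). companion_mat (G ^ k)) ps)"
    have "?D \<in> carrier_mat s s" using similar_matD[OF simZ] Z by auto
    then have D: "diag_block_mat (map (\<lambda>(G, k). companion_mat (G ^ k)) ((G, Suc k) # ps)) =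
      four_block_mat (companion_mat (G ^ Suc k)) (0\<^sub>m (degree (G ^ Suc k)) s) (0\<^sub>m s (degree (G ^ Suc k))) ?D"
      by (auto simp: Let_def)
    have "similar_mat A (diag_block_mat (map (\<lambda>(G, k). companion_mat (G ^ k)) ((G, Suc k) # ps)))"
      unfolding D
      by (rule similar_mat_trans[OF sim similar_mat_four_block_0_0[OF similar_mat_refl simZ]])
        (use Z in \<open>auto simp del: power_Suc\<close>)
    then show ?thesis using G ps by (intro exI[of _ "(G, Suc k) # ps"]) auto
  qed
qed

text \<open>The vector \<open>u\<close> with entries 1, t, ..., t^(d-1) on the coordinates of the
  block is sent by tI - A to a multiple of \<open>F\<close>. Multiplying by the adjugate shows that
  \<open>F\<close> divides every entry of the determinant times \<open>u\<close>, and
  \<open>u\<close> has the entry 1 at position \<open>c\<close>.\<close>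

lemma dvd_char_poly_if_companion_cols:
  fixes A :: "'a::field mat"
  assumes A: "A \<in> carrier_mat n n" and F: "lead_coeff F = 1" "degree F > 0" and c: "c + degree F \<le> n"
    and cols: "\<And>i j. i < n \<Longrightarrow> j < degree F \<Longrightarrow> A $$ (i, c + j) =
      (if c \<le> i \<and> i < c + degree F then companion_mat F $$ (i - c, j) else 0)"
  shows "F dvd char_poly A"
proof -
  let ?d = "degree F" and ?T = "char_poly_matrix A"
  define u where "u = Matrix.vec n (\<lambda>k. if c \<le> k \<and> k < c + ?d then monom 1 (k - c) else (0 :: 'a poly))"
  have u: "u \<in> carrier_vec n" by (simp add: u_def)
  have T: "?T \<in> carrier_mat n n" using A by simp
  have F_sum: "monom 1 ?d + (\<Sum>j<?d. [:coeff F j:] * monom 1 j) = F"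
  proof -
    have "F = (\<Sum>j<Suc ?d. monom (coeff F j) j)"
      using poly_as_sum_of_monoms[of F] by (simp only: lessThan_Suc_atMost)
    then show ?thesis using F(1) by (simp add: smult_monom add.commute)
  qed
  \<comment> \<open>The companion matrix sends \<open>(1, t, ..., t ^ (d - 1))\<close> to \<open>t\<close> times itself, up to a
    multiple of \<open>F\<close> in the last coordinate.\<close>
  have Tu: "?T *\<^sub>v u = F \<cdot>\<^sub>v unit_vec n (c + ?d - 1)"
  proof (rule eq_vecI)
    fix i assume "i < dim_vec (F \<cdot>\<^sub>v unit_vec n (c + ?d - 1))"
    then have i: "i < n" by simp
    have "(?T *\<^sub>v u) $ i = (\<Sum>k<n. ?T $$ (i, k) * u $ k)"
      using i T u by (simp add: scalar_prod_def atLeast0LessThan)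
    also have "\<dots> = (\<Sum>k\<in>{c..<c + ?d}. ?T $$ (i, k) * monom 1 (k - c))"
      using c by (intro sum.mono_neutral_cong_right) (auto simp: u_def)
    also have "\<dots> = (\<Sum>j<?d. ?T $$ (i, c + j) * monom 1 j)"
      by (rule sum.reindex_bij_witness[of _ "\<lambda>j. c + j" "\<lambda>k. k - c"]) auto
    also have "\<dots> = (\<Sum>j<?d. (if i = c + j then monom 1 (Suc j) else 0) - [:A $$ (i, c + j):] * monom 1 j)"
    proof (intro sum.cong refl)
      fix j assume "j \<in> {..<?d}"
      then have "c + j < n" using c by simp
      then have "?T $$ (i, c + j) = (if i = c + j then monom 1 1 else 0) - [:A $$ (i, c + j):]"
        using i A by (simp add: char_poly_matrix_def monom_altdef)
      then show "?T $$ (i, c + j) * monom 1 j =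
          (if i = c + j then monom 1 (Suc j) else 0) - [:A $$ (i, c + j):] * monom 1 j"
        by (simp add: left_diff_distrib mult_monom)
    qed
    also have "\<dots> = (if c \<le> i \<and> i < c + ?d then monom 1 (Suc (i - c)) else 0) -
        (\<Sum>j<?d. [:A $$ (i, c + j):] * monom 1 j)"
    proof -
      have "(\<Sum>j<?d. if i = c + j then monom 1 (Suc j) else 0) =
          (\<Sum>j<?d. if j = i - c \<and> c \<le> i then monom 1 (Suc j) else (0 :: 'a poly))"
        by (intro sum.cong) auto
      also have "\<dots> = (if c \<le> i \<and> i < c + ?d then monom 1 (Suc (i - c)) else 0)"
        by (cases "c \<le> i") auto
      finally show ?thesis by (simp add: sum_subtractf)
    qed
    also have "\<dots> = (F \<cdot>\<^sub>v unit_vec n (c + ?d - 1)) $ i"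
    proof (cases "c \<le> i \<and> i < c + ?d")
      case False
      then show ?thesis using cols i c F(2) by (auto simp: unit_vec_def)
    next
      case True
      define l where "l = i - c"
      have l: "i = c + l" "l < ?d" using True by (auto simp: l_def)
      have A_l: "A $$ (i, c + j) = (if l = ?d - 1 then - coeff F j else if j = Suc l then 1 else 0)"
        if "j < ?d" for j
        using cols[OF i that] l that by (simp add: companion_mat_def)
      show ?thesis
      proof (cases "l = ?d - 1")
        case True
        have "(\<Sum>j<?d. [:A $$ (i, c + j):] * monom 1 j) = - (\<Sum>j<?d. [:coeff F j:] * monom 1 j)"
          using A_l True by (simp add: sum_negf[symmetric])
        then show ?thesis using l True F(2) i F_sum by simp
      next
        case False
        have "(\<Sum>j<?d. [:A $$ (i, c + j):] * monom 1 j) = (\<Sum>j<?d. if j = Suc l then monom 1 j else 0)"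
          using A_l False by (intro sum.cong refl) simp
        also have "\<dots> = monom 1 (Suc l)" using False l by simp
        finally show ?thesis using l False F(2) i c by (auto simp: unit_vec_def)
      qed
    qed
    finally show "(?T *\<^sub>v u) $ i = (F \<cdot>\<^sub>v unit_vec n (c + ?d - 1)) $ i" .
  qed (use T in auto)
  let ?J = "adj_mat ?T"
  note J = adj_mat[OF T]
  have "(?J * ?T) *\<^sub>v u = ?J *\<^sub>v (?T *\<^sub>v u)"
    using J(1) T u by (simp add: assoc_mult_mat_vec[of _ n n _ n])
  also have "\<dots> = F \<cdot>\<^sub>v (?J *\<^sub>v unit_vec n (c + ?d - 1))"
    unfolding Tu using carrier_matD[OF J(1)] by (intro eq_vecI) (simp_all add: scalar_prod_smult_right)
  finally have eq: "(det ?T \<cdot>\<^sub>m 1\<^sub>m n) *\<^sub>v u = F \<cdot>\<^sub>v (?J *\<^sub>v unit_vec n (c + ?d - 1))"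
    unfolding J(3) .
  have cn: "c < n" using c F(2) by simp
  have "((det ?T \<cdot>\<^sub>m 1\<^sub>m n) *\<^sub>v u) $ c = det ?T * u $ c"
    using cn u by (simp add: scalar_prod_smult_left)
  moreover have "u $ c = 1" using cn F(2) by (simp add: u_def)
  ultimately have "det ?T = (F \<cdot>\<^sub>v (?J *\<^sub>v unit_vec n (c + ?d - 1))) $ c"
    using eq by simp
  also have "\<dots> = F * (?J *\<^sub>v unit_vec n (c + ?d - 1)) $ c"
    using cn J(1) by simp
  finally show ?thesis by (simp add: char_poly_def)
qed

text \<open>Taking all columns as one block gives divisibility, and both polynomials are monic of
  the same degree. Degree 0 is separate because a column block has to be nonempty.\<close>

lemma char_poly_companion_mat:
  fixes f :: "'a::field poly"
  assumes f: "lead_coeff f = 1"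
  shows "char_poly (companion_mat f) = f"
proof (cases "degree f = 0")
  case True
  then have "f = 1" using f by (auto simp: one_pCons elim!: degree_eq_zeroE)
  moreover have "det (char_poly_matrix (companion_mat f)) = 1"
    using True by (intro det_dim_zero) (metis char_poly_matrix_closed companion_mat_carrier)
  ultimately show ?thesis by (simp add: char_poly_def)
next
  case False
  have "f dvd char_poly (companion_mat f)"
    by (rule dvd_char_poly_if_companion_cols[of _ "degree f" f 0]) (use f False in auto)
  then obtain g where g: "char_poly (companion_mat f) = f * g" ..
  have deg: "degree (char_poly (companion_mat f)) = degree f" "lead_coeff (char_poly (companion_mat f)) = 1"
    using degree_monic_char_poly[of "companion_mat f" "degree f"] by auto
  then have "f * g \<noteq> 0" using f g by auto
  then have "f \<noteq> 0" "g \<noteq> 0" by auto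
  then have "degree g = 0" using deg(1) unfolding g by (simp add: degree_mult_eq)
  moreover have "lead_coeff g = 1" using deg(2) f unfolding g by (simp add: lead_coeff_mult)
  ultimately have "g = 1" by (auto simp: one_pCons elim!: degree_eq_zeroE)
  then show ?thesis using g by simp
qed

section \<open>Characteristic polynomials and reordering of block diagonal matrices\<close>

lemma char_poly_four_block_diag:
  fixes A :: "'a::idom mat"
  assumes A: "A \<in> carrier_mat n n" and D: "D \<in> carrier_mat m m"
  shows "char_poly (four_block_mat A (0\<^sub>m n m) (0\<^sub>m m n) D) = char_poly A * char_poly D"
proof -
  have "char_poly_matrix (four_block_mat A (0\<^sub>m n m) (0\<^sub>m m n) D) =
      four_block_mat (char_poly_matrix A) (0\<^sub>m n m) (0\<^sub>m m n) (char_poly_matrix D)"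
    using A D by (intro eq_matI) (auto simp: char_poly_matrix_def)
  then show ?thesis
    using A D by (simp add: char_poly_def det_four_block_mat_lower_left_zero[of _ n _ m])
qed

lemma square_mat_carrier: "square_mat A \<Longrightarrow> A \<in> carrier_mat (dim_row A) (dim_row A)"
  by (rule carrier_matI) simp_all

lemma char_poly_diag_block_mat:
  fixes As :: "'a::idom mat list"
  assumes "\<And>A. A \<in> set As \<Longrightarrow> square_mat A"
  shows "char_poly (diag_block_mat As) = prod_list (map char_poly As)"
  using assms
proof (induction As)
  case Nil
  then show ?case by (simp add: char_poly_def char_poly_matrix_def)
next
  case (Cons A As)
  define n where "n = dim_row A"
  define m where "m = dim_row (diag_block_mat As)"
  have A: "A \<in> carrier_mat n n" unfolding n_def by (intro square_mat_carrier Cons.prems) simp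
  have D: "diag_block_mat As \<in> carrier_mat m m"
    unfolding m_def by (intro square_mat_carrier diag_block_mat_square ballI Cons.prems) simp
  have "char_poly (diag_block_mat (A # As)) = char_poly A * char_poly (diag_block_mat As)"
    using char_poly_four_block_diag[OF A D] carrier_matD[OF A] carrier_matD[OF D] by (simp add: Let_def)
  then show ?case using Cons by simp
qed

lemma similar_mat_four_block_swap:
  fixes A :: "'a::comm_ring_1 mat"
  assumes A: "A \<in> carrier_mat n n" and D: "D \<in> carrier_mat m m"
  shows "similar_mat (four_block_mat A (0\<^sub>m n m) (0\<^sub>m m n) D) (four_block_mat D (0\<^sub>m m n) (0\<^sub>m n m) A)"
proof -
  let ?P = "four_block_mat (0\<^sub>m n m) (1\<^sub>m n) (1\<^sub>m m) (0\<^sub>m m n) :: 'a mat"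
  let ?Q = "four_block_mat (0\<^sub>m m n) (1\<^sub>m m) (1\<^sub>m n) (0\<^sub>m n m) :: 'a mat"
  let ?E = "four_block_mat D (0\<^sub>m m n) (0\<^sub>m n m) A"
  have PQ: "?P * ?Q = 1\<^sub>m (n + m)"
    by (subst mult_four_block_mat[of _ n m _ n _ m _ _ n _ m]) auto
  have QP: "?Q * ?P = 1\<^sub>m (n + m)"
    by (subst mult_four_block_mat[of _ m n _ m _ n _ _ m _ n]) (auto simp: add.commute[of n m])
  have "?P * ?E = four_block_mat (0\<^sub>m n m) A D (0\<^sub>m m n)"
    using A D by (subst mult_four_block_mat[of _ n m _ n _ m _ _ m _ n]) auto
  then have eq: "?P * ?E * ?Q = four_block_mat A (0\<^sub>m n m) (0\<^sub>m m n) D"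
    using A D by (simp, subst mult_four_block_mat[of _ n m _ n _ m _ _ n _ m]) auto
  moreover have "?P \<in> carrier_mat (n + m) (n + m)" "?Q \<in> carrier_mat (n + m) (n + m)"
    "?E \<in> carrier_mat (n + m) (n + m)" "four_block_mat A (0\<^sub>m n m) (0\<^sub>m m n) D \<in> carrier_mat (n + m) (n + m)"
    using carrier_matD[OF A] carrier_matD[OF D] by (auto intro!: carrier_matI)
  ultimately show ?thesis by (intro similar_matI[OF _ PQ QP eq[symmetric]]) blast
qed

text \<open>This passes from the order in which blocks are split off to the grouped and sorted order
  of \<open>is_rcf\<close>. The tail is permuted by induction, then the head \<open>A\<close> is
  moved past the blocks \<open>Bs1\<close> by one block swap.\<close>

lemma similar_diag_block_mat_perm:
  fixes As Bs :: "'a::comm_ring_1 mat list"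
  assumes "mset As = mset Bs" "\<And>A. A \<in> set As \<Longrightarrow> square_mat A"
  shows "similar_mat (diag_block_mat As) (diag_block_mat Bs)"
  using assms
proof (induction As arbitrary: Bs)
  case Nil
  then show ?case by (simp add: similar_mat_refl[of _ 0])
next
  case (Cons A As)
  have "A \<in> set Bs" using Cons.prems(1) by (metis list.set_intros(1) set_mset_mset)
  then obtain Bs1 Bs2 where Bs: "Bs = Bs1 @ A # Bs2" by (meson split_list)
  have ms: "mset As = mset (Bs1 @ Bs2)" using Cons.prems(1) by (simp add: Bs)
  obtain a where A: "A \<in> carrier_mat a a" using square_mat_carrier[OF Cons.prems(2)[of A]] by auto
  have sq: "square_mat X" if "X \<in> set (Bs1 @ Bs2)" for X
    using that Cons.prems(2) ms by (metis list.set_intros(2) set_mset_mset)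
  define C where "C = diag_block_mat Bs1"
  define D where "D = diag_block_mat Bs2"
  define c where "c = dim_row C"
  define e where "e = dim_row D"
  have C: "C \<in> carrier_mat c c" and D: "D \<in> carrier_mat e e"
    unfolding C_def D_def c_def e_def by (intro square_mat_carrier diag_block_mat_square ballI sq; simp)+
  have sim: "similar_mat (diag_block_mat As) (diag_block_mat (Bs1 @ Bs2))"
    using Cons.IH[OF ms] Cons.prems(2) by simp
  obtain x where X: "diag_block_mat As \<in> carrier_mat x x" and Y: "diag_block_mat (Bs1 @ Bs2) \<in> carrier_mat x x"
    using similar_matD[OF sim] by blast
  have "similar_mat (diag_block_mat (A # As)) (diag_block_mat (A # Bs1 @ Bs2))"
    unfolding diag_block_mat.simps Let_def carrier_matD[OF X] carrier_matD[OF Y] carrier_matD[OF A]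
    by (rule similar_mat_four_block_0_0[OF similar_mat_refl[OF A] sim A X])
  moreover have "similar_mat (diag_block_mat ((A # Bs1) @ Bs2)) (diag_block_mat ((Bs1 @ [A]) @ Bs2))"
  proof -
    have swap: "similar_mat (diag_block_mat (A # Bs1)) (diag_block_mat (Bs1 @ [A]))"
      unfolding diag_block_mat.simps diag_block_mat_last Let_def C_def[symmetric]
        carrier_matD[OF A] carrier_matD[OF C]
      by (rule similar_mat_four_block_swap[OF A C])
    obtain y where V: "diag_block_mat (A # Bs1) \<in> carrier_mat y y" and W: "diag_block_mat (Bs1 @ [A]) \<in> carrier_mat y y"
      using similar_matD[OF swap] by blast
    show ?thesis
      unfolding diag_block_mat_append[of "A # Bs1"] diag_block_mat_append[of "Bs1 @ [A]"] Let_def D_def[symmetric]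
        carrier_matD[OF D] carrier_matD[OF V] carrier_matD[OF W]
      by (rule similar_mat_four_block_0_0[OF swap similar_mat_refl[OF D] V D])
  qed
  ultimately show ?case using similar_mat_trans by (simp add: Bs)
qed

lemma mset_concat_filter_fst:
  assumes "distinct Gs" "fst ` set ps \<subseteq> set Gs"
  shows "mset (concat (map (\<lambda>G. filter (\<lambda>p. fst p = G) ps) Gs)) = mset ps"
proof -
  have "mset (concat (map (\<lambda>G. filter (\<lambda>p. fst p = G) ps) Gs)) = filter_mset (\<lambda>p. fst p \<in> set Gs) (mset ps)"
    using assms(1)
  proof (induction Gs)
    case (Cons G Gs)
    then show ?case
      by (auto simp: multiset_eq_iff)
  qed simp
  also have "\<dots> = mset ps"
    using assms(2) by (intro filter_mset_eq_conv[THEN iffD2]) auto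
  finally show ?thesis .
qed

section \<open>Existence of the rational canonical form and its nonzero partitions\<close>

lemma monic_irreducible_dvd_imp_eq:
  fixes G H :: "'a::field poly"
  assumes "lead_coeff G = 1" "irreducible G" "lead_coeff H = 1" "irreducible H" "H dvd G"
  shows "H = G"
proof -
  obtain c where c: "G = H * c" using assms(5) by (elim dvdE)
  then have "c dvd 1" using irreducibleD[OF assms(2) c] irreducible_not_unit[OF assms(4)] by blast
  then obtain a where "c = [:a:]" by (auto elim: degree_eq_zeroE)
  moreover from this have "a = 1" using c assms(1,3) by (cases "a = 0") auto
  ultimately have "c = 1" by (simp add: one_pCons)
  then show ?thesis using c by simp
qed

lemma irreducible_dvd_prod_list:
  fixes H :: "'a::field poly"
  assumes "irreducible H" "H dvd prod_list fs"
  shows "\<exists>f\<in>set fs. H dvd f"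
  using assms(2) field_poly_irreducible_imp_prime[OF assms(1)] irreducible_not_unit[OF assms(1)]
  by (induction fs) (auto simp: prime_elem_dvd_mult_iff)

text \<open>The blocks of \<open>companion_decomposition\<close> are grouped by irreducible
  polynomial and sorted by exponent. Existence ensures that the choice in
  \<open>rcf_partition\<close> picks a genuine canonical form.\<close>

lemma rcf_exists:
  fixes A :: "'k::{field, finite} mat"
  assumes A: "A \<in> carrier_mat n n"
  shows "\<exists>L. is_rcf A L"
proof -
  obtain ps where ps: "\<And>G k. (G, k) \<in> set ps \<Longrightarrow> lead_coeff G = 1 \<and> irreducible G \<and> k > 0"
    and sim: "similar_mat A (diag_block_mat (map (\<lambda>(G, k). companion_mat (G ^ k)) ps))"
    using companion_decomposition[OF A] by auto
  define Gs where "Gs = remdups (map fst ps)"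
  \<comment> \<open>The exponents belonging to \<open>G\<close>, in decreasing order.
    \<open>L\<close> continues them by zeros; as all exponents are positive, the number of parts is
    the length of \<open>ks G\<close>.\<close>
  define ks where "ks = (\<lambda>G. rev (sort (map snd (filter (\<lambda>p. fst p = G) ps))))"
  define L where "L = (\<lambda>G j. if j < length (ks G) then ks G ! j else 0)"
  have ks_pos: "k > 0" if "k \<in> set (ks G)" for G k
    using that ps by (force simp: ks_def)
  have L_pos: "{j. L G j > 0} = {..<length (ks G)}" for G
    using ks_pos[OF nth_mem] by (auto simp: L_def)
  have part: "L G \<in> partitions" for G
  proof -
    have "sorted_wrt (\<ge>) (ks G)" by (simp add: ks_def sorted_wrt_rev)
    then have "decseq (L G)"
      by (auto simp: L_def monotone_def sorted_wrt_iff_nth_less le_less)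
    then show ?thesis by (simp add: partitions_def L_pos)
  qed
  have blocks: "companion_blocks G (L G) = map (\<lambda>k. companion_mat (G ^ k)) (ks G)" for G
  proof -
    have "num_parts (L G) = length (ks G)" by (simp add: num_parts_def L_pos)
    then show ?thesis by (intro nth_equalityI) (auto simp: companion_blocks_def L_def)
  qed
  \<comment> \<open>From this product the monic irreducible factors of the characteristic polynomial
    are read off: they are the first components of \<open>ps\<close>.\<close>
  have char: "char_poly A = (\<Prod>(G, k)\<leftarrow>ps. G ^ k)"
  proof -
    have "char_poly A = char_poly (diag_block_mat (map (\<lambda>(G, k). companion_mat (G ^ k)) ps))"
      by (rule char_poly_similar[OF sim])
    also have "\<dots> = (\<Prod>(G, k)\<leftarrow>ps. char_poly (companion_mat (G ^ k)))"
      by (subst char_poly_diag_block_mat) (auto simp: comp_def case_prod_unfold)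
    also have "\<dots> = (\<Prod>(G, k)\<leftarrow>ps. G ^ k)"
      using ps by (intro arg_cong[of _ _ prod_list] map_cong refl) (auto intro!: char_poly_companion_mat monic_power)
    finally show ?thesis .
  qed
  have Gs: "set Gs = irred_factors A"
  proof (intro equalityI subsetI)
    fix G assume "G \<in> set Gs"
    then obtain k where Gk: "(G, k) \<in> set ps" by (auto simp: Gs_def)
    have "G ^ k dvd char_poly A"
      unfolding char using Gk by (intro prod_list_dvd) force
    moreover have "G dvd G ^ k" using ps[OF Gk] by simp
    ultimately have "G dvd char_poly A" using dvd_trans by blast
    then show "G \<in> irred_factors A" using ps[OF Gk] by (simp add: irred_factors_def)
  next
    fix H assume "H \<in> irred_factors A"
    then have H: "lead_coeff H = 1" "irreducible H" "H dvd (\<Prod>(G, k)\<leftarrow>ps. G ^ k)"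
      by (auto simp: irred_factors_def char)
    then obtain G k where Gk: "(G, k) \<in> set ps" "H dvd G ^ k"
      using irreducible_dvd_prod_list[OF H(2,3)] by auto
    then have "H dvd G" using field_poly_irreducible_imp_prime[OF H(2)] prime_elem_dvd_power by blast
    then have "H = G" using monic_irreducible_dvd_imp_eq H(1,2) ps[OF Gk(1)] by blast
    then show "H \<in> set Gs" using Gk by (force simp: Gs_def)
  qed
  have "mset (concat (map (\<lambda>G. companion_blocks G (L G)) Gs)) =
      mset (map (\<lambda>(G, k). companion_mat (G ^ k)) ps)"
  proof -
    have "mset (companion_blocks G (L G)) =
        image_mset (\<lambda>(G, k). companion_mat (G ^ k)) (mset (filter (\<lambda>p. fst p = G) ps))" for G
    proof -
      have "mset (companion_blocks G (L G)) =
          mset (map (\<lambda>k. companion_mat (G ^ k)) (map snd (filter (\<lambda>p. fst p = G) ps)))"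
        unfolding blocks ks_def mset_map mset_rev mset_sort ..
      also have "map (\<lambda>k. companion_mat (G ^ k)) (map snd (filter (\<lambda>p. fst p = G) ps)) =
          map (\<lambda>(G, k). companion_mat (G ^ k)) (filter (\<lambda>p. fst p = G) ps)"
        by auto
      finally show ?thesis by (simp only: mset_map)
    qed
    then have "mset (concat (map (\<lambda>G. companion_blocks G (L G)) Gs)) =
        image_mset (\<lambda>(G, k). companion_mat (G ^ k)) (mset (concat (map (\<lambda>G. filter (\<lambda>p. fst p = G) ps) Gs)))"
      by (induction Gs) auto
    then show ?thesis by (simp add: mset_concat_filter_fst Gs_def)
  qed
  then have "similar_mat (diag_block_mat (map (\<lambda>(G, k). companion_mat (G ^ k)) ps))
      (diag_block_mat (concat (map (\<lambda>G. companion_blocks G (L G)) Gs)))"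
    by (intro similar_diag_block_mat_perm) auto
  then have "similar_mat A (diag_block_mat (concat (map (\<lambda>G. companion_blocks G (L G)) Gs)))"
    using sim similar_mat_trans by blast
  moreover have "L G = (\<lambda>_. 0)" if "G \<notin> irred_factors A" for G
  proof -
    have "filter (\<lambda>p. fst p = G) ps = []"
      using that Gs by (force simp: filter_empty_conv Gs_def)
    then show ?thesis by (simp add: L_def ks_def)
  qed
  ultimately have "is_rcf A L"
    unfolding is_rcf_def using part Gs by (intro conjI allI impI exI[of _ Gs]) (auto simp: Gs_def)
  then show ?thesis by (intro exI[of _ L])
qed

text \<open>\<open>F\<close> divides the characteristic polynomial of some block, which is a power
  of some \<open>G\<close>, so \<open>F = G\<close> and this block belongs to \<open>L F\<close>. As
  \<open>L\<close> is arbitrary, the result covers whichever form the choice operator picks.\<close>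

lemma rcf_nonzero_if_dvd_char_poly:
  assumes rcf: "is_rcf A L" and F: "lead_coeff F = 1" "irreducible F" "F dvd char_poly A"
  shows "L F \<noteq> (\<lambda>_. 0)"
proof
  assume zero: "L F = (\<lambda>_. 0)"
  obtain Gs where Gs: "set Gs = irred_factors A"
    and sim: "similar_mat A (diag_block_mat (concat (map (\<lambda>G. companion_blocks G (L G)) Gs)))"
    using rcf by (auto simp: is_rcf_def)
  let ?Bs = "concat (map (\<lambda>G. companion_blocks G (L G)) Gs)"
  have "char_poly A = prod_list (map char_poly ?Bs)"
    unfolding char_poly_similar[OF sim]
    by (rule char_poly_diag_block_mat) (auto simp: companion_blocks_def)
  then obtain G j where G: "G \<in> set Gs" "j < num_parts (L G)" "F dvd char_poly (companion_mat (G ^ L G j))"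
    using irreducible_dvd_prod_list[OF F(2), of "map char_poly ?Bs"] F(3)
    by (auto simp: companion_blocks_def)
  have G': "lead_coeff G = 1" "irreducible G" using G(1) Gs by (auto simp: irred_factors_def)
  then have "F dvd G ^ L G j" using G(3) by (simp add: char_poly_companion_mat monic_power)
  then have "F dvd G" using field_poly_irreducible_imp_prime[OF F(2)] prime_elem_dvd_power by blast
  then have "F = G" using monic_irreducible_dvd_imp_eq F(1,2) G' by blast
  then show False using G(2) zero by (simp add: num_parts_def)
qed

lemma rcf_partition_nonzero_if_dvd_char_poly:
  fixes A :: "'k::{field, finite} mat"
  assumes "A \<in> carrier_mat n n" "lead_coeff F = 1" "irreducible F" "F dvd char_poly A"
  shows "rcf_partition F A \<noteq> (\<lambda>_. 0)"
proof -
  have "is_rcf A (SOME L. is_rcf A L)" using rcf_exists[OF assms(1)] by (rule someI_ex)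
  then show ?thesis unfolding rcf_partition_def by (rule rcf_nonzero_if_dvd_char_poly) fact+
qed

subsection \<open>Independent events indexed by matrix entries\<close>

lemma block_index_less:
  fixes b d n r :: nat
  assumes "b < n div d" "r < d"
  shows "b * d + r < n"
proof -
  have "b * d + r < Suc b * d" using assms by simp
  also have "\<dots> \<le> (n div d) * d" using assms by (intro mult_right_mono) auto
  finally show ?thesis by (rule less_le_trans) simp
qed

context prob_space
begin

text \<open>The event that block \<open>b\<close> is not full is a difference: the event for
  \<open>S\<close> minus the event for \<open>S\<close> enlarged by \<open>K b\<close>. Keeping
  \<open>S\<close> arbitrary in the induction on \<open>J\<close> therefore reduces everything to
  the product rule for joint occurrence.\<close>

lemma prob_blocks_not_contained:
  fixes E :: "'i \<Rightarrow> 'a \<Rightarrow> bool" and K :: "'b \<Rightarrow> 'i set"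
  assumes I: "finite I"
    and meas: "\<And>x. x \<in> I \<Longrightarrow> {w \<in> space M. E x w} \<in> events"
    and indep: "\<And>T. T \<subseteq> I \<Longrightarrow> prob {w \<in> space M. \<forall>x\<in>T. E x w} = q ^ card T"
    and J: "finite J" and K: "disjoint_family_on K J" "\<And>b. b \<in> J \<Longrightarrow> K b \<subseteq> I"
    and S: "S \<subseteq> I" "\<And>b. b \<in> J \<Longrightarrow> S \<inter> K b = {}"
  shows "prob {w \<in> space M. (\<forall>x\<in>S. E x w) \<and> (\<forall>b\<in>J. \<exists>x\<in>K b. \<not> E x w)} =
    q ^ card S * (\<Prod>b\<in>J. 1 - q ^ card (K b))"
  using J K S
proof (induction J arbitrary: S rule: finite_induct)
  case empty
  then show ?case using indep by simp
next
  case (insert b J)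
  have fin: "finite T" if "T \<subseteq> I" for T
    using that I by (rule finite_subset)
  have m: "{w \<in> space M. (\<forall>x\<in>T. E x w) \<and> (\<forall>b\<in>J. \<exists>x\<in>K b. \<not> E x w)} \<in> events"
    if "T \<subseteq> I" for T
  proof (intro sets.sets_Collect_conj sets.sets_Collect_finite_All sets.sets_Collect_finite_Ex sets.sets_Collect_neg)
    show "{w \<in> space M. E x w} \<in> events" if "x \<in> T" for x
      using that \<open>T \<subseteq> I\<close> meas by blast
    show "{w \<in> space M. E x w} \<in> events" if "x \<in> K b" "b \<in> J" for x b
      using that insert.prems(2) meas by blast
    show "finite (K b)" if "b \<in> J" for b
      using that insert.prems(2) fin by blast
  qed (use fin[OF that] insert.hyps in auto)
  let ?P = "\<lambda>T. {w \<in> space M. (\<forall>x\<in>T. E x w) \<and> (\<forall>b\<in>J. \<exists>x\<in>K b. \<not> E x w)}"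
  have Sb: "S \<union> K b \<subseteq> I" using insert.prems by auto
  have disj: "K b \<inter> K c = {}" if "c \<in> J" for c
    using insert.prems(1) insert.hyps(2) that unfolding disjoint_family_on_def by auto
  have split: "{w \<in> space M. (\<forall>x\<in>S. E x w) \<and> (\<forall>b\<in>insert b J. \<exists>x\<in>K b. \<not> E x w)} =
      ?P S - ?P (S \<union> K b)"
    by auto
  have "prob (?P S - ?P (S \<union> K b)) = prob (?P S) - prob (?P (S \<union> K b))"
    using m[OF \<open>S \<subseteq> I\<close>] m[OF Sb] by (intro finite_measure_Diff) auto
  moreover have "prob (?P S) = q ^ card S * (\<Prod>b\<in>J. 1 - q ^ card (K b))"
  proof (intro insert.IH)
    fix c assume "c \<in> J"
    then show "S \<inter> K c = {}"
      using insert.prems(4)[of c] by simp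
  qed (use insert.prems in \<open>auto simp: disjoint_family_on_def\<close>)
  moreover have "prob (?P (S \<union> K b)) = q ^ card (S \<union> K b) * (\<Prod>b\<in>J. 1 - q ^ card (K b))"
  proof (intro insert.IH)
    fix c assume "c \<in> J"
    then show "(S \<union> K b) \<inter> K c = {}"
      using insert.prems(4)[of c] disj by (simp add: Int_Un_distrib2)
  qed (use insert.prems Sb in \<open>auto simp: disjoint_family_on_def\<close>)
  moreover have "card (S \<union> K b) = card S + card (K b)"
    using insert.prems fin by (intro card_Un_disjoint) auto
  ultimately show ?case
    unfolding split using insert.hyps by (simp add: power_add algebra_simps)
qed

text \<open>Adding the index \<open>m\<close> removes the part of \<open>Z m\<close> disjoint from
  all earlier events, whose probability is at least that of \<open>R\<close> and \<open>Z m\<close>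
  minus the pairwise overlaps, by subadditivity.\<close>

lemma bonferroni_upper2:
  fixes Z :: "nat \<Rightarrow> 'a \<Rightarrow> bool"
  assumes R: "{w \<in> space M. R w} \<in> events"
    and Z: "\<And>j. j < m \<Longrightarrow> {w \<in> space M. Z j w} \<in> events"
  shows "prob {w \<in> space M. R w \<and> (\<forall>j<m. \<not> Z j w)} \<le>
    prob {w \<in> space M. R w} - (\<Sum>j<m. prob {w \<in> space M. R w \<and> Z j w})
      + (\<Sum>j<m. \<Sum>i<j. prob {w \<in> space M. R w \<and> Z i w \<and> Z j w})"
  using Z
proof (induction m)
  case 0
  then show ?case by simp
next
  case (Suc m)
  let ?A = "{w \<in> space M. R w \<and> (\<forall>j<m. \<not> Z j w)}"
  let ?B = "\<lambda>i. {w \<in> space M. R w \<and> Z i w \<and> Z m w}"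
  have Zm: "{w \<in> space M. Z j w} \<in> events" if "j \<le> m" for j
    using Suc.prems that by auto
  have mA: "?A \<in> events"
  proof -
    have "?A = {w \<in> space M. R w \<and> (\<forall>j\<in>{..<m}. \<not> Z j w)}" by auto
    also have "\<dots> \<in> events"
      using R Zm by (intro sets.sets_Collect_conj sets.sets_Collect_finite_All sets.sets_Collect_neg) auto
    finally show ?thesis .
  qed
  have m1: "{w \<in> space M. R w \<and> Z m w} \<in> events" and mB: "\<And>i. i < m \<Longrightarrow> ?B i \<in> events"
    using R Zm by (auto intro!: sets.sets_Collect_conj)
  have m2: "{w \<in> ?A. Z m w} \<in> events"
  proof -
    have "{w \<in> ?A. Z m w} = ?A \<inter> {w \<in> space M. Z m w}" by auto
    then show ?thesis using sets.Int[OF mA Zm[of m]] by simp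
  qed
  have "prob {w \<in> space M. R w \<and> Z m w} \<le> prob ({w \<in> ?A. Z m w} \<union> (\<Union>i<m. ?B i))"
    using m2 mB by (intro finite_measure_mono) auto
  moreover have "prob ({w \<in> ?A. Z m w} \<union> (\<Union>i<m. ?B i)) \<le> prob {w \<in> ?A. Z m w} + prob (\<Union>i<m. ?B i)"
    using m2 mB by (intro measure_Un_le) auto
  moreover have "prob (\<Union>i<m. ?B i) \<le> (\<Sum>i<m. prob (?B i))"
    using mB by (intro finite_measure_subadditive_finite) auto
  ultimately have *: "prob {w \<in> space M. R w \<and> Z m w} - (\<Sum>i<m. prob (?B i)) \<le> prob {w \<in> ?A. Z m w}"
    by linarith
  have split: "{w \<in> space M. R w \<and> (\<forall>j<Suc m. \<not> Z j w)} = ?A - {w \<in> ?A. Z m w}"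
    by (auto simp: less_Suc_eq)
  have "prob (?A - {w \<in> ?A. Z m w}) = prob ?A - prob {w \<in> ?A. Z m w}"
    using mA m2 by (intro finite_measure_Diff) auto
  also have "\<dots> \<le> prob ?A - prob {w \<in> space M. R w \<and> Z m w} + (\<Sum>i<m. prob (?B i))"
    using * by simp
  finally show ?case
    unfolding split using Suc.IH Suc.prems by simp
qed

text \<open>The block columns are disjoint sets of \<open>n * d\<close> entries, so
  \<open>prob_blocks_not_contained\<close> applies with empty \<open>S\<close>.\<close>

lemma prob_no_full_block:
  assumes meas: "\<And>i j. i < n \<Longrightarrow> j < n \<Longrightarrow> {w \<in> space M. E (i, j) w} \<in> events"
    and indep: "\<And>T. T \<subseteq> {..<n} \<times> {..<n} \<Longrightarrow> prob {w \<in> space M. \<forall>x\<in>T. E x w} = q ^ card T"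
  shows "prob {w \<in> space M. \<forall>b<n div d. \<exists>i<n. \<exists>r<d. \<not> E (i, b * d + r) w} =
    (1 - q ^ (n * d)) ^ (n div d)"
proof -
  let ?K = "\<lambda>b. {..<n} \<times> {b * d..<b * d + d}"
  have lt: "b * d + r < n" if "b < n div d" "r < d" for b r
    using that by (rule block_index_less)
  have sub: "?K b \<subseteq> {..<n} \<times> {..<n}" if "b < n div d" for b
    using lt[OF that] by (auto simp: le_iff_add)
  have dis: "{b * d..<b * d + d} \<inter> {c * d..<c * d + d} = {}" if "b < c" for b c :: nat
  proof -
    have "Suc b * d \<le> c * d" using that by (intro mult_right_mono) auto
    then show ?thesis by auto
  qed
  have "disjoint_family_on ?K {..<n div d}"
    unfolding disjoint_family_on_def
  proof (intro ballI impI)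
    fix b c :: nat assume "b \<noteq> c"
    then show "?K b \<inter> ?K c = {}"
      using dis[of b c] dis[of c b] by (cases "b < c") auto
  qed
  then have "prob {w \<in> space M. (\<forall>x\<in>{}. E x w) \<and> (\<forall>b\<in>{..<n div d}. \<exists>x\<in>?K b. \<not> E x w)} =
      q ^ card ({} :: (nat \<times> nat) set) * (\<Prod>b<n div d. 1 - q ^ card (?K b))"
    by (intro prob_blocks_not_contained[where I="{..<n} \<times> {..<n}"] indep sub)
      (use meas in \<open>auto simp del: mem_Sigma_iff elim!: SigmaE\<close>)
  then have "prob {w \<in> space M. \<forall>b\<in>{..<n div d}. \<exists>x\<in>?K b. \<not> E x w} = (1 - q ^ (n * d)) ^ (n div d)"
    by (simp add: card_cartesian_product)
  moreover have "(\<exists>x\<in>?K b. \<not> E x w) \<longleftrightarrow> (\<exists>i<n. \<exists>r<d. \<not> E (i, b * d + r) w)" for b w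
  proof -
    have "{b * d..<b * d + d} = (\<lambda>r. b * d + r) ` {..<d}"
      using image_add_atLeastLessThan[of "b * d" 0 d] by (simp add: atLeast0LessThan add.commute)
    then show ?thesis by auto
  qed
  ultimately show ?thesis by (simp add: Ball_def)
qed

text \<open>Once the columns in \<open>T\<close> are prescribed, a row can only fail through its
  \<open>n - card T\<close> other entries, and these sets are disjoint for different rows.\<close>

lemma prob_no_full_row_full_cols:
  assumes meas: "\<And>i j. i < n \<Longrightarrow> j < n \<Longrightarrow> {w \<in> space M. E (i, j) w} \<in> events"
    and indep: "\<And>T. T \<subseteq> {..<n} \<times> {..<n} \<Longrightarrow> prob {w \<in> space M. \<forall>x\<in>T. E x w} = q ^ card T"
    and T: "T \<subseteq> {..<n}"
  shows "prob {w \<in> space M. (\<forall>i<n. \<exists>j<n. \<not> E (i, j) w) \<and> (\<forall>j\<in>T. \<forall>i<n. E (i, j) w)} =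
    (q ^ card T - q ^ n) ^ n"
proof -
  have fT: "finite T" "card T \<le> n"
    using T finite_subset card_mono[OF _ T] by auto
  let ?K = "\<lambda>i. {i} \<times> ({..<n} - T)" and ?S = "{..<n} \<times> T"
  have cK: "card (?K i) = n - card T" for i
    using T fT by (simp add: card_cartesian_product card_Diff_subset)
  have "disjoint_family_on ?K {..<n}"
    by (auto simp: disjoint_family_on_def)
  then have "prob {w \<in> space M. (\<forall>x\<in>?S. E x w) \<and> (\<forall>i\<in>{..<n}. \<exists>x\<in>?K i. \<not> E x w)} =
      q ^ card ?S * (\<Prod>i<n. 1 - q ^ card (?K i))"
    by (intro prob_blocks_not_contained[where I="{..<n} \<times> {..<n}"] indep)
      (use meas T in auto)
  moreover have "{w \<in> space M. (\<forall>x\<in>?S. E x w) \<and> (\<forall>i\<in>{..<n}. \<exists>x\<in>?K i. \<not> E x w)} =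
      {w \<in> space M. (\<forall>i<n. \<exists>j<n. \<not> E (i, j) w) \<and> (\<forall>j\<in>T. \<forall>i<n. E (i, j) w)}"
    using T by fastforce
  moreover have "q ^ card ?S * (\<Prod>i<n. 1 - q ^ card (?K i)) = (q ^ card T * (1 - q ^ (n - card T))) ^ n"
    unfolding cK by (simp add: card_cartesian_product power_mult_distrib mult.commute flip: power_mult)
  moreover have "q ^ card T * (1 - q ^ (n - card T)) = q ^ card T - q ^ n"
    using fT by (simp add: algebra_simps flip: power_add)
  ultimately show ?thesis by simp
qed

text \<open>Rows and columns overlap, so there is no product formula. The rows are treated exactly,
  and second order Bonferroni is applied to the columns inside the event that no row is
  full.\<close>

lemma prob_no_full_row_no_full_col_le:
  assumes meas: "\<And>i j. i < n \<Longrightarrow> j < n \<Longrightarrow> {w \<in> space M. E (i, j) w} \<in> events"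
    and indep: "\<And>T. T \<subseteq> {..<n} \<times> {..<n} \<Longrightarrow> prob {w \<in> space M. \<forall>x\<in>T. E x w} = q ^ card T"
  shows "prob {w \<in> space M. (\<forall>i<n. \<exists>j<n. \<not> E (i, j) w) \<and> (\<forall>j<n. \<exists>i<n. \<not> E (i, j) w)} \<le>
    (1 - q ^ n) ^ n - real n * (q - q ^ n) ^ n + real (n choose 2) * (q\<^sup>2 - q ^ n) ^ n"
proof -
  let ?R = "\<lambda>w. \<forall>i<n. \<exists>j<n. \<not> E (i, j) w" and ?Z = "\<lambda>j w. \<forall>i<n. E (i, j) w"
  have full: "prob {w \<in> space M. ?R w \<and> (\<forall>j\<in>T. \<forall>i<n. E (i, j) w)} = (q ^ card T - q ^ n) ^ n"
    if "T \<subseteq> {..<n}" for T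
    using meas indep that by (rule prob_no_full_row_full_cols)
  have "{w \<in> space M. ?R w} \<in> events" "\<And>j. j < n \<Longrightarrow> {w \<in> space M. ?Z j w} \<in> events"
  proof -
    have "{w \<in> space M. \<forall>i\<in>{..<n}. \<exists>j\<in>{..<n}. \<not> E (i, j) w} \<in> events"
      using meas by (intro sets.sets_Collect_finite_All sets.sets_Collect_finite_Ex sets.sets_Collect_neg) auto
    moreover have "{w \<in> space M. ?R w} = {w \<in> space M. \<forall>i\<in>{..<n}. \<exists>j\<in>{..<n}. \<not> E (i, j) w}" by auto
    ultimately show "{w \<in> space M. ?R w} \<in> events" by simp
    fix j assume "j < n"
    have "{w \<in> space M. ?Z j w} = {w \<in> space M. \<forall>i\<in>{..<n}. E (i, j) w}" by auto
    also have "\<dots> \<in> events"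
      using meas \<open>j < n\<close> by (intro sets.sets_Collect_finite_All) auto
    finally show "{w \<in> space M. ?Z j w} \<in> events" .
  qed
  from bonferroni_upper2[OF this]
  have "prob {w \<in> space M. ?R w \<and> (\<forall>j<n. \<not> ?Z j w)} \<le>
    prob {w \<in> space M. ?R w} - (\<Sum>j<n. prob {w \<in> space M. ?R w \<and> ?Z j w})
      + (\<Sum>j<n. \<Sum>i<j. prob {w \<in> space M. ?R w \<and> ?Z i w \<and> ?Z j w})" .
  moreover have "prob {w \<in> space M. ?R w} = (1 - q ^ n) ^ n"
    using full[of "{}"] by simp
  moreover have "(\<Sum>j<n. prob {w \<in> space M. ?R w \<and> ?Z j w}) = (\<Sum>j<n. (q - q ^ n) ^ n)"
    using full[of "{j}" for j] by (intro sum.cong) auto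
  moreover have "(\<Sum>j<n. \<Sum>i<j. prob {w \<in> space M. ?R w \<and> ?Z i w \<and> ?Z j w}) =
      (\<Sum>j<n. \<Sum>i<j. (q\<^sup>2 - q ^ n) ^ n)"
  proof (intro sum.cong refl)
    fix j i assume "j \<in> {..<n}" "i \<in> {..<j}"
    then show "prob {w \<in> space M. ?R w \<and> ?Z i w \<and> ?Z j w} = (q\<^sup>2 - q ^ n) ^ n"
      using full[of "{i, j}"] by (simp add: numeral_2_eq_2)
  qed
  moreover have "(\<Sum>j<n. \<Sum>i<j. (q\<^sup>2 - q ^ n) ^ n) = real (\<Sum>j<n. j) * (q\<^sup>2 - q ^ n) ^ n"
    by (simp add: sum_distrib_right)
  moreover have "(\<Sum>j<n. j) = n choose 2"
    by (simp add: choose_two Sum_Ico_nat flip: atLeast0LessThan)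
  ultimately show ?thesis by simp
qed

end

subsection \<open>Asymptotic estimates\<close>

text \<open>The extra term \<open>x ^ (N + 2)\<close> makes the induction work: multiplication by
  \<open>1 - x ^ (N + 2)\<close> turns it into the next power plus the nonnegative rest
  \<open>x ^ (N + 2) * (x\<^sup>2 - x ^ (N + 2))\<close>.\<close>

lemma euler_prod_partial_ge:
  fixes x :: real
  assumes "0 \<le> x" "x \<le> 1"
  shows "1 - x - x\<^sup>2 + x ^ (N + 2) \<le> (\<Prod>l\<le>N. 1 - x ^ Suc l)"
proof (induction N)
  case 0
  then show ?case by (simp add: power2_eq_square)
next
  case (Suc N)
  have le: "x ^ (N + 2) \<le> x\<^sup>2"
    using assms by (intro power_decreasing) auto
  have "1 - x - x\<^sup>2 + x ^ (Suc N + 2) \<le>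
      1 - x - x\<^sup>2 + x ^ (Suc N + 2) + x ^ (N + 2) * (x\<^sup>2 - x ^ (N + 2))"
    using le assms by simp
  also have "\<dots> = (1 - x - x\<^sup>2 + x ^ (N + 2)) * (1 - x ^ (N + 2))"
    by (simp add: algebra_simps power2_eq_square)
  also have "\<dots> \<le> (\<Prod>l\<le>N. 1 - x ^ Suc l) * (1 - x ^ (N + 2))"
    using Suc assms by (intro mult_right_mono) (auto simp: power_le_one simp del: power_Suc)
  finally show ?case by simp
qed

lemma euler_prod_ge:
  fixes x :: real
  assumes "0 \<le> x" "x < 1"
  shows "1 - x - x\<^sup>2 \<le> (\<Prod>l. 1 - x ^ Suc l)"
proof -
  have "summable (\<lambda>l. norm (1 - x ^ Suc l - 1))"
    using assms by (simp add: summable_mult summable_geometric)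
  then have "convergent_prod (\<lambda>l. 1 - x ^ Suc l)"
    by (intro abs_convergent_prod_imp_convergent_prod summable_imp_abs_convergent_prod)
  then have "(\<lambda>N. \<Prod>l\<le>N. 1 - x ^ Suc l) \<longlonglongrightarrow> (\<Prod>l. 1 - x ^ Suc l)"
    by (rule convergent_prod_LIMSEQ)
  moreover have "1 - x - x\<^sup>2 \<le> (\<Prod>l\<le>N. 1 - x ^ Suc l)" for N
    using euler_prod_partial_ge[of x N] assms by (smt (verit) zero_le_power)
  ultimately show ?thesis
    by (intro LIMSEQ_le_const) auto
qed

text \<open>The bound 1/2 is what balancedness asks for: the value taken with probability \<alpha>
  must not exceed 1 - \<alpha>.\<close>

lemma alpha_seq_bounds:
  assumes "d \<ge> 1"
  shows "\<forall>\<^sub>F n in sequentially. 0 < alpha_seq d n \<and> alpha_seq d n \<le> 1 / 2"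
proof -
  have d: "real d > 0" using assms by simp
  have "eventually (\<lambda>x::real. 0 < ln x / (d * x) \<and> ln x / (d * x) \<le> 1 / 2) at_top"
    using d by (intro eventually_conj; real_asymp)
  then show ?thesis
    unfolding alpha_seq_def by (rule eventually_compose_filterlim[OF _ filterlim_real_sequentially])
qed

text \<open>A block column is unperturbed with probability \<open>q n\<close>, where n times
  \<open>q n\<close> tends to 1. With 1 - x \<le> exp(-x), the power is bounded by a sequence
  tending to exp(-1/d).\<close>

lemma eventually_no_full_block_less:
  assumes "d \<ge> 1" "exp (- 1 / real d) < c"
  shows "\<forall>\<^sub>F n in sequentially. (1 - (1 - alpha_seq d n) ^ (n * d)) ^ (n div d) < c"
proof -
  define q where "q = (\<lambda>n. (1 - alpha_seq d n) ^ (n * d))"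
  have d: "real d > 0" using assms by simp
  have "((\<lambda>x::real. x * (1 - ln x / (d * x)) powr (x * d)) \<longlongrightarrow> 1) at_top"
    using d by real_asymp
  then have "(\<lambda>n. real n * (1 - ln (real n) / (d * real n)) powr (real n * d)) \<longlonglongrightarrow> 1"
    by (rule filterlim_compose[OF _ filterlim_real_sequentially])
  moreover have "\<forall>\<^sub>F n in sequentially. real n * (1 - ln (real n) / (d * real n)) powr (real n * d) = real n * q n"
    using alpha_seq_bounds[OF assms(1)]
  proof eventually_elim
    case (elim n)
    then have "0 < 1 - ln (real n) / (d * real n)" unfolding alpha_seq_def by linarith
    then show ?case
      using powr_realpow[of "1 - ln (real n) / (d * real n)" "n * d"] by (simp add: q_def alpha_seq_def)
  qed
  ultimately have lim: "(\<lambda>n. real n * q n) \<longlonglongrightarrow> 1"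
    by (rule Lim_transform_eventually)
  have "(\<lambda>n. real n * q n * (1 / real n)) \<longlonglongrightarrow> 1 * 0"
    by (intro tendsto_mult lim lim_1_over_n)
  moreover have "\<forall>\<^sub>F n in sequentially. real n * q n * (1 / real n) = q n"
    using eventually_gt_at_top[of 0] by eventually_elim simp
  ultimately have "q \<longlonglongrightarrow> 0"
    by (simp add: Lim_transform_eventually)
  then have "(\<lambda>n. exp (- (real n * q n / d - q n))) \<longlonglongrightarrow> exp (- (1 / d - 0))"
    using d by (intro tendsto_intros lim) auto
  then have "\<forall>\<^sub>F n in sequentially. exp (- (real n * q n / d - q n)) < c"
    using assms(2) by (intro order_tendstoD) auto
  then show ?thesis
    using alpha_seq_bounds[OF assms(1)]
  proof eventually_elim
    case (elim n)
    have q: "0 \<le> q n" "q n \<le> 1"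
      using elim by (auto simp: q_def power_le_one)
    \<comment> \<open>Rounding down the number of blocks costs at most one \<open>q n\<close> in the
      exponent, and \<open>q n\<close> tends to 0.\<close>
    have "real n / d - 1 \<le> real (n div d)"
    proof -
      have "real n = real (n div d) * d + real (n mod d)"
        by (metis div_mult_mod_eq of_nat_add of_nat_mult)
      moreover have "real (n mod d) \<le> d" using assms by (simp add: less_imp_le)
      ultimately show ?thesis using d by (simp add: field_simps)
    qed
    then have "(real n / d - 1) * q n \<le> real (n div d) * q n"
      using q by (intro mult_right_mono)
    moreover have "(1 - q n) ^ (n div d) \<le> exp (- q n) ^ (n div d)"
      using q exp_ge_add_one_self[of "- q n"] by (intro power_mono) auto
    moreover have "exp (- q n) ^ (n div d) = exp (- (real (n div d) * q n))"
      by (simp flip: exp_of_nat_mult)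
    ultimately have "(1 - q n) ^ (n div d) \<le> exp (- ((real n / d - 1) * q n))"
      by (smt (verit) exp_le_cancel_iff)
    also have "(real n / d - 1) * q n = real n * q n / d - q n"
      by (simp add: left_diff_distrib)
    finally have "(1 - q n) ^ (n div d) \<le> exp (- (real n * q n / d - q n))" .
    then show ?case using elim by (simp add: q_def)
  qed
qed

text \<open>Here \<open>q n ^ n\<close> is asymptotic to 1/n, so the three terms tend to exp(-1),
  exp(-1) and exp(-1)/2; the first two cancel.\<close>

lemma tendsto_bonferroni_bound:
  defines "q \<equiv> \<lambda>n. 1 - alpha_seq 1 n"
  shows "(\<lambda>n. (1 - q n ^ n) ^ n - real n * (q n - q n ^ n) ^ n + real (n choose 2) * ((q n)\<^sup>2 - q n ^ n) ^ n)
    \<longlonglongrightarrow> exp (- 1) / 2"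
proof -
  define f :: "real \<Rightarrow> real" where
    "f = (\<lambda>x. (1 - (1 - ln x / x) powr x) powr x - x * ((1 - ln x / x) - (1 - ln x / x) powr x) powr x
      + x * (x - 1) / 2 * ((1 - ln x / x) ^ 2 - (1 - ln x / x) powr x) powr x)"
  have "((\<lambda>x::real. (1 - (1 - ln x / x) powr x) powr x) \<longlongrightarrow> exp (- 1)) at_top"
    "((\<lambda>x::real. x * ((1 - ln x / x) - (1 - ln x / x) powr x) powr x) \<longlongrightarrow> exp (- 1)) at_top"
    "((\<lambda>x::real. x * (x - 1) / 2 * ((1 - ln x / x) ^ 2 - (1 - ln x / x) powr x) powr x) \<longlongrightarrow> exp (- 1) / 2) at_top"
    by real_asymp+
  from tendsto_add[OF tendsto_diff[OF this(1,2)] this(3)]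
  have "(f \<longlongrightarrow> exp (- 1) / 2) at_top" by (simp add: f_def)
  then have "(\<lambda>n. f (real n)) \<longlonglongrightarrow> exp (- 1) / 2"
    by (rule filterlim_compose[OF _ filterlim_real_sequentially])
  \<comment> \<open>Positivity of the bases allows \<open>powr\<close>, used for the limits over the
    reals, to be replaced by natural powers.\<close>
  moreover have "eventually (\<lambda>x::real. 0 < 1 - ln x / x \<and> 0 < 1 - (1 - ln x / x) powr x \<and>
      0 < (1 - ln x / x) - (1 - ln x / x) powr x \<and> 0 < (1 - ln x / x) ^ 2 - (1 - ln x / x) powr x) at_top"
    by (intro eventually_conj; real_asymp)
  then have "eventually (\<lambda>n. 0 < 1 - ln (real n) / n \<and> 0 < 1 - (1 - ln (real n) / n) powr n \<and>
      0 < (1 - ln (real n) / n) - (1 - ln (real n) / n) powr n \<and>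
      0 < (1 - ln (real n) / n) ^ 2 - (1 - ln (real n) / n) powr n) sequentially"
    by (rule eventually_compose_filterlim[OF _ filterlim_real_sequentially])
  then have "\<forall>\<^sub>F n in sequentially. f (real n) =
      (1 - q n ^ n) ^ n - real n * (q n - q n ^ n) ^ n + real (n choose 2) * ((q n)\<^sup>2 - q n ^ n) ^ n"
    using eventually_gt_at_top[of 0]
  proof eventually_elim
    case (elim n)
    have "real (n choose 2) = real n * (real n - 1) / 2"
      using elim by (simp add: choose_two real_of_nat_div of_nat_diff)
    then show ?case
      using elim by (simp add: f_def q_def alpha_seq_def powr_realpow)
  qed
  ultimately show ?thesis by (rule Lim_transform_eventually)
qed

text \<open>From exp(1/d) > 1 + 1/d the left side is below 1 - 1/(d+1). At the largest admissible
  \<open>x\<close> the sum of \<open>x\<close> and its square is (d+3)/(d+2)^2, at most 1/(d+1)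
  since (d+1)(d+3) \<le> (d+2)^2.\<close>

lemma exp_minus_inverse_less:
  fixes x :: real
  assumes "d \<ge> 1" "0 \<le> x" "x \<le> 1 / (real d + 2)"
  shows "exp (- 1 / real d) < 1 - x - x\<^sup>2"
proof -
  have d: "real d > 0" using assms by simp
  have "0 < (1 / real d)\<^sup>2 / 2" using d by simp
  then have "1 + 1 / real d < exp (1 / real d)"
    using exp_lower_Taylor_quadratic[of "1 / real d"] by (smt (verit) zero_le_divide_1_iff of_nat_0_le_iff)
  then have "exp (- 1 / real d) < 1 / (1 + 1 / real d)"
    using d by (simp add: exp_minus field_simps)
  also have "\<dots> = 1 - 1 / (real d + 1)"
    using d by (simp add: field_simps)
  also have "\<dots> \<le> 1 - (1 / (real d + 2) + (1 / (real d + 2))\<^sup>2)"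
  proof -
    have "1 / (real d + 2) + (1 / (real d + 2))\<^sup>2 = (real d + 3) / (real d + 2)\<^sup>2"
      using d by (simp add: add_frac_eq power2_eq_square divide_simps)
    also have "\<dots> \<le> (real d + 3) / ((real d + 3) * (real d + 1))"
      using d by (intro divide_left_mono) (auto simp: power2_eq_square algebra_simps intro!: mult_pos_pos add_pos_pos)
    also have "\<dots> = 1 / (real d + 1)"
      using d by simp
    finally show ?thesis by simp
  qed
  also have "\<dots> \<le> 1 - x - x\<^sup>2"
    using assms power_mono[of x "1 / (real d + 2)" 2] by linarith
  finally show ?thesis .
qed

subsection \<open>Failure of convergence\<close>

text \<open>The module of the empty partition is trivial and has one automorphism, which leaves the
  bare Euler product.\<close>

lemma mu_empty_partition:
  fixes F :: "'k::{field, finite} poly"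
  shows "mu F (\<lambda>_. 0) = (\<Prod>l. 1 - (1 / real CARD('k) ^ degree F) ^ Suc l)"
proof -
  let ?z = "(\<lambda>_. 0) :: nat \<Rightarrow> 'k poly"
  have mod: "primary_module F (\<lambda>_. 0) = {?z}"
    by (auto simp: primary_module_def fun_eq_iff)
  have "primary_Aut F (\<lambda>_. 0) = {restrict (\<lambda>_. ?z) {?z}}"
  proof (intro equalityI subsetI)
    fix \<phi> assume "\<phi> \<in> primary_Aut F (\<lambda>_. 0)"
    then have "\<phi> \<in> extensional {?z}" "\<phi> ?z = ?z"
      unfolding primary_Aut_def mod by (auto simp: bij_betw_def)
    then have "\<phi> = restrict (\<lambda>_. ?z) {?z}"
      by (intro extensionalityI[of _ "{?z}"]) auto
    then show "\<phi> \<in> {restrict (\<lambda>_. ?z) {?z}}" by simp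
  next
    fix \<phi> assume "\<phi> \<in> {restrict (\<lambda>_. ?z) {?z}}"
    then show "\<phi> \<in> primary_Aut F (\<lambda>_. 0)"
      unfolding primary_Aut_def mod by (auto simp: bij_betw_def primary_smult_def)
  qed
  moreover have "1 / real CARD('k) ^ (Suc l * degree F) = (1 / real CARD('k) ^ degree F) ^ Suc l" for l
    by (simp add: power_one_over mult.commute[of "Suc l"] power_mult del: power_Suc mult_Suc mult_Suc_right)
  ultimately show ?thesis by (simp add: mu_def del: power_Suc mult_Suc)
qed

section \<open>Unperturbed block columns and rows\<close>

lemma index_diag_block_mat_replicate:
  assumes C: "C \<in> carrier_mat d d" and "b < m" "r < d" "i < m * d + dim_row R"
  shows "diag_block_mat (replicate m C @ [R]) $$ (i, b * d + r) =
    (if b * d \<le> i \<and> i < b * d + d then C $$ (i - b * d, r) else 0)"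
  using assms(2-)
proof (induction m arbitrary: b i)
  case 0
  then show ?case by simp
next
  case (Suc m)
  let ?D = "diag_block_mat (replicate m C @ [R])"
  have D: "dim_row ?D = m * d + dim_row R" "dim_col ?D = m * d + dim_col R"
    using C by (simp_all add: dim_diag_block_mat sum_list_replicate)
  show ?case
  proof (cases b)
    case 0
    then show ?thesis using Suc.prems C D by (auto simp: Let_def)
  next
    case (Suc b')
    have "b' * d + r < m * d"
    proof -
      have "b' * d + r < Suc b' * d" using Suc.prems by simp
      also have "\<dots> \<le> m * d" using Suc Suc.prems by (intro mult_right_mono) auto
      finally show ?thesis .
    qed
    then show ?thesis
      using Suc.IH[of b' "i - d"] Suc Suc.prems C D by (auto simp: Let_def)
  qed
qed

lemma index_companion_block_mat:
  assumes "is_companion_block_mat F n B" and "b < n div degree F" "r < degree F" "i < n"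
  shows "B $$ (i, b * degree F + r) =
    (if b * degree F \<le> i \<and> i < b * degree F + degree F then companion_mat F $$ (i - b * degree F, r) else 0)"
proof -
  obtain R where "R \<in> carrier_mat (n mod degree F) (n mod degree F)"
    "B = diag_block_mat (replicate (n div degree F) (companion_mat F) @ [R])"
    using assms(1) by (auto simp: is_companion_block_mat_def)
  then show ?thesis
    using index_diag_block_mat_replicate[OF companion_mat_carrier[of F] assms(2,3), of i R] assms(4)
    by simp
qed

lemma rcf_partition_nonzero_if_companion_cols:
  fixes A :: "'k::{field, finite} mat"
  assumes A: "A \<in> carrier_mat n n" and F: "lead_coeff F = 1" "irreducible F" "degree F > 0"
    and B: "is_companion_block_mat F n B" and b: "b < n div degree F"
    and eq: "\<And>i r. i < n \<Longrightarrow> r < degree F \<Longrightarrow> A $$ (i, b * degree F + r) = B $$ (i, b * degree F + r)"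
  shows "rcf_partition F A \<noteq> (\<lambda>_. 0)"
proof (rule rcf_partition_nonzero_if_dvd_char_poly[OF A F(1,2)],
    rule dvd_char_poly_if_companion_cols[OF A F(1,3), of "b * degree F"])
  have "Suc b * degree F \<le> (n div degree F) * degree F"
    using b by (intro mult_right_mono) auto
  also have "\<dots> \<le> n" by simp
  finally show "b * degree F + degree F \<le> n" by (simp add: add.commute)
qed (simp add: eq index_companion_block_mat[OF B b])

text \<open>For \<open>degree F = 1\<close> the matrix \<open>B\<close> is scalar, so an unperturbed
  row is a companion column of the transpose, which has the same characteristic polynomial.\<close>

lemma rcf_partition_nonzero_if_companion_row:
  fixes A :: "'k::{field, finite} mat"
  assumes A: "A \<in> carrier_mat n n" and F: "lead_coeff F = 1" "irreducible F" "degree F = 1"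
    and B: "is_companion_block_mat F n B" and i: "i < n"
    and eq: "\<And>j. j < n \<Longrightarrow> A $$ (i, j) = B $$ (i, j)"
  shows "rcf_partition F A \<noteq> (\<lambda>_. 0)"
proof (rule rcf_partition_nonzero_if_dvd_char_poly[OF A F(1,2)])
  have B_index: "B $$ (i, j) = (if i = j then companion_mat F $$ (0, 0) else 0)" if "j < n" for j
    using index_companion_block_mat[OF B, of j 0 i] that i F(3) by auto
  have "F dvd char_poly (transpose_mat A)"
    by (rule dvd_char_poly_if_companion_cols[of _ n F i]) (use A F i eq B_index in auto)
  then show "F dvd char_poly A" using A by simp
qed

section \<open>Probability of the empty partition\<close>

context prob_space
begin

lemma prob_entries_eq:
  assumes X: "indep_entries M n X"
    and q: "\<And>i j. i < n \<Longrightarrow> j < n \<Longrightarrow> prob {w \<in> space M. X w $$ (i, j) = B $$ (i, j)} = q"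
    and T: "T \<subseteq> {..<n} \<times> {..<n}"
  shows "prob {w \<in> space M. \<forall>x\<in>T. X w $$ x = B $$ x} = q ^ card T"
\<comment> \<open>An intersection over the empty set would be the whole type instead of
  \<open>space M\<close>.\<close>
proof (cases "T = {}")
  case True
  then show ?thesis by (simp add: prob_space)
next
  case False
  have "finite T" using T finite_subset by blast
  have "prob (\<Inter>x\<in>T. (\<lambda>w. X w $$ x) -` {B $$ x} \<inter> space M) =
      (\<Prod>x\<in>T. prob ((\<lambda>w. X w $$ x) -` {B $$ x} \<inter> space M))"
    using indep_varsD[OF X[unfolded indep_entries_def], of T "\<lambda>x. {B $$ x}"] False \<open>finite T\<close> T by simp
  also have "\<dots> = (\<Prod>x\<in>T. q)"
  proof (intro prod.cong refl)
    fix x assume "x \<in> T"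
    then obtain i j where "x = (i, j)" "i < n" "j < n" using T by (cases x) auto
    then show "prob ((\<lambda>w. X w $$ x) -` {B $$ x} \<inter> space M) = q"
      using q[of i j] by (simp add: vimage_def Int_def conj_commute)
  qed
  also have "(\<Inter>x\<in>T. (\<lambda>w. X w $$ x) -` {B $$ x} \<inter> space M) = {w \<in> space M. \<forall>x\<in>T. X w $$ x = B $$ x}"
    using False by auto
  finally show ?thesis by simp
qed

lemma entry_event:
  assumes "random_matrix M n X" "i < n" "j < n"
  shows "{w \<in> space M. X w $$ (i, j) = a} \<in> events"
proof -
  have "(\<lambda>w. X w $$ (i, j)) \<in> measurable M (count_space UNIV)"
    using assms by (auto simp: random_matrix_def)
  from measurable_sets[OF this, of "{a}"] show ?thesis
    by (simp add: vimage_def Int_def conj_commute)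
qed

text \<open>Every value other than that of \<open>B\<close> lies in the complementary event, of
  probability \<alpha> \<le> 1/2 \<le> 1 - \<alpha>.\<close>

lemma balanced_mat_if_two_valued:
  assumes X: "random_matrix M n X" "indep_entries M n X"
    and q: "\<And>i j. i < n \<Longrightarrow> j < n \<Longrightarrow> prob {w \<in> space M. X w $$ (i, j) = B $$ (i, j)} = 1 - \<alpha>"
    and \<alpha>: "0 < \<alpha>" "\<alpha> \<le> 1 / 2"
  shows "balanced_mat M n \<alpha> X"
  unfolding balanced_mat_def balanced_var_def
proof (intro conjI allI impI X \<alpha>(1))
  fix i j a assume ij: "i < n" "j < n"
  show "(\<lambda>w. X w $$ (i, j)) \<in> measurable M (count_space UNIV)"
    using X(1) ij by (auto simp: random_matrix_def)
  note ev = entry_event[OF X(1) ij]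
  show "prob {w \<in> space M. X w $$ (i, j) = a} \<le> 1 - \<alpha>"
  proof (cases "a = B $$ (i, j)")
    case False
    have "prob {w \<in> space M. X w $$ (i, j) = a} \<le> prob (space M - {w \<in> space M. X w $$ (i, j) = B $$ (i, j)})"
      using ev False by (intro finite_measure_mono) auto
    also have "\<dots> = \<alpha>" using q[OF ij] ev by (simp add: prob_compl)
    finally show ?thesis using \<alpha> by simp
  qed (use q[OF ij] in simp)
qed

lemma prob_rcf_empty_le:
  fixes X :: "'a \<Rightarrow> 'k::{field, finite} mat"
  assumes X: "random_matrix M n X" "indep_entries M n X"
    and q: "\<And>i j. i < n \<Longrightarrow> j < n \<Longrightarrow> prob {w \<in> space M. X w $$ (i, j) = B $$ (i, j)} = q"
    and F: "lead_coeff F = 1" "irreducible F" "degree F > 0" and B: "is_companion_block_mat F n B"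
  shows "prob {w \<in> space M. rcf_partition F (X w) = (\<lambda>_. 0)} \<le> (1 - q ^ (n * degree F)) ^ (n div degree F)"
proof -
  let ?E = "\<lambda>x w. X w $$ x = B $$ x" and ?d = "degree F"
  have carrier: "X w \<in> carrier_mat n n" if "w \<in> space M" for w
    using X(1) that by (auto simp: random_matrix_def)
  let ?U = "{w \<in> space M. \<forall>b<n div ?d. \<exists>i<n. \<exists>r<?d. \<not> ?E (i, b * ?d + r) w}"
  have lt: "b * ?d + r < n" if "b < n div ?d" "r < ?d" for b r
    using that by (rule block_index_less)
  have "?U = {w \<in> space M. \<forall>b\<in>{..<n div ?d}. \<exists>i\<in>{..<n}. \<exists>r\<in>{..<?d}. \<not> ?E (i, b * ?d + r) w}"
    by (simp add: Ball_def Bex_def)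
  also have "\<dots> \<in> events"
    using entry_event[OF X(1)] lt
    by (intro sets.sets_Collect_finite_All sets.sets_Collect_finite_Ex sets.sets_Collect_neg) auto
  finally have U: "?U \<in> events" .
  \<comment> \<open>Monotonicity of the measure asks for measurability of the larger event, which is
    why \<open>?U\<close> was shown to be one.\<close>
  have "{w \<in> space M. rcf_partition F (X w) = (\<lambda>_. 0)} \<subseteq> ?U"
    using rcf_partition_nonzero_if_companion_cols[OF carrier F B] by blast
  then have "prob {w \<in> space M. rcf_partition F (X w) = (\<lambda>_. 0)} \<le> prob ?U"
    using U by (rule finite_measure_mono)
  also have "\<dots> = (1 - q ^ (n * ?d)) ^ (n div ?d)"
    using entry_event[OF X(1)] prob_entries_eq[OF X(2) q] by (intro prob_no_full_block) auto
  finally show ?thesis .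
qed

lemma prob_rcf_empty_le_linear:
  fixes X :: "'a \<Rightarrow> 'k::{field, finite} mat"
  assumes X: "random_matrix M n X" "indep_entries M n X"
    and q: "\<And>i j. i < n \<Longrightarrow> j < n \<Longrightarrow> prob {w \<in> space M. X w $$ (i, j) = B $$ (i, j)} = q"
    and F: "lead_coeff F = 1" "irreducible F" "degree F = 1" and B: "is_companion_block_mat F n B"
  shows "prob {w \<in> space M. rcf_partition F (X w) = (\<lambda>_. 0)} \<le>
    (1 - q ^ n) ^ n - real n * (q - q ^ n) ^ n + real (n choose 2) * (q\<^sup>2 - q ^ n) ^ n"
proof -
  let ?E = "\<lambda>x w. X w $$ x = B $$ x"
  have carrier: "X w \<in> carrier_mat n n" if "w \<in> space M" for w
    using X(1) that by (auto simp: random_matrix_def)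
  let ?U = "{w \<in> space M. (\<forall>i<n. \<exists>j<n. \<not> ?E (i, j) w) \<and> (\<forall>j<n. \<exists>i<n. \<not> ?E (i, j) w)}"
  have "?U = {w \<in> space M. (\<forall>i\<in>{..<n}. \<exists>j\<in>{..<n}. \<not> ?E (i, j) w) \<and> (\<forall>j\<in>{..<n}. \<exists>i\<in>{..<n}. \<not> ?E (i, j) w)}"
    by auto
  also have "\<dots> \<in> events"
    using entry_event[OF X(1)]
    by (intro sets.sets_Collect_conj sets.sets_Collect_finite_All sets.sets_Collect_finite_Ex
        sets.sets_Collect_neg) auto
  finally have U: "?U \<in> events" .
  have "{w \<in> space M. rcf_partition F (X w) = (\<lambda>_. 0)} \<subseteq> ?U"
  proof safe
    fix w i assume w: "w \<in> space M" "rcf_partition F (X w) = (\<lambda>_. 0)" and i: "i < n"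
    show "\<exists>j<n. \<not> ?E (i, j) w"
      using rcf_partition_nonzero_if_companion_row[OF carrier[OF w(1)] F B i] w(2) by blast
    show "\<exists>j<n. \<not> ?E (j, i) w"
      using rcf_partition_nonzero_if_companion_cols[OF carrier[OF w(1)] F(1,2) _ B, of i] F(3) w(2) i by auto
  qed
  then have "prob {w \<in> space M. rcf_partition F (X w) = (\<lambda>_. 0)} \<le> prob ?U"
    using U by (rule finite_measure_mono)
  also have "\<dots> \<le> (1 - q ^ n) ^ n - real n * (q - q ^ n) ^ n + real (n choose 2) * (q\<^sup>2 - q ^ n) ^ n"
    using entry_event[OF X(1)] prob_entries_eq[OF X(2) q] by (intro prob_no_full_row_no_full_col_le) auto
  finally show ?thesis .
qed

end

theorem mainTheorem4:
  fixes p d :: nat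
    and F :: "'k::{field, finite} poly"
    and B :: "nat \<Rightarrow> 'k mat"
    and M :: "nat \<Rightarrow> 'w measure"
    and A :: "nat \<Rightarrow> 'w \<Rightarrow> 'k mat"
  assumes "prime p" and "CARD('k) = p"
    and "lead_coeff F = 1" and "irreducible F" and "degree F = d" and "d \<ge> 1"
    and "\<And>n. n \<ge> 1 \<Longrightarrow> is_companion_block_mat F n (B n)"
    and "\<And>n. n \<ge> 1 \<Longrightarrow> prob_space (M n)"
    and "\<And>n. n \<ge> 1 \<Longrightarrow> random_matrix (M n) n (A n)"
    and "\<And>n. n \<ge> 1 \<Longrightarrow> indep_entries (M n) n (A n)"
    and "\<And>n i j. n \<ge> 1 \<Longrightarrow> i < n \<Longrightarrow> j < n \<Longrightarrow>
           measure (M n) {w \<in> space (M n). A n w $$ (i, j) = B n $$ (i, j)} = 1 - alpha_seq d n"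
    and "\<And>n i j. n \<ge> 1 \<Longrightarrow> i < n \<Longrightarrow> j < n \<Longrightarrow>
           measure (M n) {w \<in> space (M n). A n w $$ (i, j) = B n $$ (i, j) + 1} = alpha_seq d n"
  shows "(\<forall>\<^sub>F n in sequentially. balanced_mat (M n) n (alpha_seq d n) (A n)) \<and>
    \<not> (\<forall>lam\<in>partitions.
         (\<lambda>n. measure (M n) {w \<in> space (M n). rcf_partition F (A n w) = lam})
           \<longlonglongrightarrow> mu F lam)"
proof
  note F = assms(3,4) and B = assms(7) and M = assms(8) and A = assms(9,10,11)
  show "\<forall>\<^sub>F n in sequentially. balanced_mat (M n) n (alpha_seq d n) (A n)"
    using alpha_seq_bounds[OF \<open>d \<ge> 1\<close>] eventually_ge_at_top[of 1]
    by eventually_elim (auto intro!: prob_space.balanced_mat_if_two_valued[where B="B _"] M A)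
  define x where "x = 1 / real p ^ d"
  define P where "P = (\<lambda>n. measure (M n) {w \<in> space (M n). rcf_partition F (A n w) = (\<lambda>_. 0)})"
  have "p \<ge> 2" using \<open>prime p\<close> by (rule prime_ge_2_nat)
  have p_pow: "real p ^ d \<ge> 2 ^ d" using \<open>p \<ge> 2\<close> by (intro power_mono) auto
  have x: "0 \<le> x" "x \<le> 1 / 2 ^ d"
    using p_pow \<open>p \<ge> 2\<close> by (auto simp: x_def intro!: divide_left_mono mult_pos_pos)
  have "1 / 2 ^ d < (1 :: real)" using \<open>d \<ge> 1\<close> by simp
  then have "x < 1" using x(2) by linarith
  have mu: "1 - x - x\<^sup>2 \<le> mu F (\<lambda>_. 0)"
    using euler_prod_ge[OF x(1) \<open>x < 1\<close>] assms(2,5) by (simp add: mu_empty_partition x_def)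
  \<comment> \<open>A constant strictly below the lower bound for \<open>mu\<close> is required. For
    \<open>d = 1\<close> and \<open>p = 2\<close> that bound is 1/4, which exp(-1) exceeds, so
    columns alone do not suffice there.\<close>
  have "\<exists>c < 1 - x - x\<^sup>2. \<forall>\<^sub>F n in sequentially. P n \<le> c"
  proof (cases "d = 1")
    case True
    have "x \<le> 1 / 2" using x True by simp
    moreover have "x\<^sup>2 \<le> (1 / 2)\<^sup>2" using x(1) \<open>x \<le> 1 / 2\<close> by (intro power_mono)
    \<comment> \<open>The constant 22/100 separates exp(-1)/2, at most 1/5, from 1/4, the value of
      \<open>1 - x - x\<^sup>2\<close> at 1/2.\<close>
    ultimately have less: "22 / 100 < 1 - x - x\<^sup>2" by (simp add: power2_eq_square)
    have "5 / 2 \<le> exp (1 :: real)" using exp_lower_Taylor_quadratic[of 1] by simp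
    then have "exp (- 1) / 2 < (22 / 100 :: real)" by (simp add: exp_minus field_simps)
    from order_tendstoD(2)[OF tendsto_bonferroni_bound this] eventually_ge_at_top[of 1]
    have "\<forall>\<^sub>F n in sequentially. P n \<le> 22 / 100"
    proof eventually_elim
      case (elim n)
      then show ?case
        using prob_space.prob_rcf_empty_le_linear[OF M A F _ B, of n] assms(5) True unfolding P_def by fastforce
    qed
    then show ?thesis using less by blast
  next
    case False
    then have "2 \<le> d" using \<open>d \<ge> 1\<close> by simp
    \<comment> \<open>This starts at \<open>d = 2\<close> with equality; it puts \<open>x\<close> in
      the range of \<open>exp_minus_inverse_less\<close> for every prime \<open>p\<close>.\<close>
    then have "d + 2 \<le> 2 ^ d" by (induction d rule: dec_induct) auto
    then have "real d + 2 \<le> 2 ^ d" by (metis of_nat_add of_nat_le_iff of_nat_numeral of_nat_power)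
    then have "1 / 2 ^ d \<le> 1 / (real d + 2)" by (intro divide_left_mono) auto
    then have "exp (- 1 / real d) < 1 - x - x\<^sup>2"
      using x \<open>d \<ge> 1\<close> by (intro exp_minus_inverse_less) auto
    then obtain c where c: "exp (- 1 / real d) < c" "c < 1 - x - x\<^sup>2" using dense by blast
    from eventually_no_full_block_less[OF \<open>d \<ge> 1\<close> c(1)] eventually_ge_at_top[of 1]
    have "\<forall>\<^sub>F n in sequentially. P n \<le> c"
    proof eventually_elim
      case (elim n)
      then show ?case
        using prob_space.prob_rcf_empty_le[OF M A F _ B, of n] assms(5,6) unfolding P_def by fastforce
    qed
    then show ?thesis using c(2) by blast
  qed
  then obtain c where c: "c < 1 - x - x\<^sup>2" "\<forall>\<^sub>F n in sequentially. P n \<le> c" by blast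
  show "\<not> (\<forall>lam\<in>partitions.
      (\<lambda>n. measure (M n) {w \<in> space (M n). rcf_partition F (A n w) = lam}) \<longlonglongrightarrow> mu F lam)"
  proof
    assume conv: "\<forall>lam\<in>partitions.
      (\<lambda>n. measure (M n) {w \<in> space (M n). rcf_partition F (A n w) = lam}) \<longlonglongrightarrow> mu F lam"
    have "(\<lambda>_. 0) \<in> partitions" by (simp add: partitions_def decseq_def)
    with conv have "P \<longlonglongrightarrow> mu F (\<lambda>_. 0)" unfolding P_def by blast
    then have "mu F (\<lambda>_. 0) \<le> c" using c(2) by (rule tendsto_upperbound) simp
    then show False using mu c(1) by simp
  qed
qed

end
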